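(* Let $G$ be a finite simple non-complete connected graph on $[n]=\{1,\ldots,n\}$. Then the following statements are equivalent: (a) $f(G) + \operatorname{diam}(G) = n + 2 - \kappa(G)$. (b) $G\in \mathcal{G}_{\operatorname{diam}(G)}$, or $\kappa(G)\ge 2$ and $G\in \mathcal{F}_{\kappa(G)}$.
   Context: For a finite simple connected graph $G$: $\operatorname{diam}(G)$ is the diameter (maximum distance between two vertices). For non-complete $G$, $\kappa(G)$ is the vertex connectivity, i.e. the smallest cardinality of a set $T$ of vertices such that the induced subgraph of $G$ on the complement of $T$ is disconnected. A vertex is free if any two distinct neighbors of it are adjacent; $f(G)$ is the number of free vertices of $G$. $N_H(x)$ denotes the set of neighbors of a vertex $x$ in a graph $H$. $K_m$ is the complete graph on $m$ vertices ($K_0$ is the empty graph). Membership in the families below is understood up to graph isomorphism. The family $\mathcal{G}_d$ ($d\ge 2$ an integer). Let $P$ be the path $v,u_1,\ldots,u_{d-1},w$ of length $d$. Let $H^v$ and $H^w$ be complete graphs isomorphic to $K_t$ and $K_s$ respectively, with $t,s\ge 0$. Let $\mathcal{H}_1,\ldots,\mathcal{H}_{d-1}$ and $\mathcal{H}_{1,2},\mathcal{H}_{2,3},\ldots,\mathcal{H}_{d-2,d-1}$ be finite (possibly empty) families of complete graphs (for $d=2$ there are no families $\mathcal{H}_{j,j+1}$). The vertex sets of $P$, $H^v$, $H^w$ and of all members of all these families are pairwise disjoint. For a family $\mathcal{T}$ of graphs write $V(\mathcal{T})=\bigcup_{G\in\mathcal{T}}V(G)$. Let $H$ be the graph on the vertex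 set $$\{v,u_1,\ldots,u_{d-1},w\}\cup V(H^v)\cup V(H^w)\cup \bigcup_{i=1}^{d-1}V(\mathcal{H}_i)\cup \bigcup_{j=1}^{d-2}V(\mathcal{H}_{j,j+1})$$ such that $N_H(v)=\{u_1\}\cup V(H^v)$, $N_H(w)=\{u_{d-1}\}\cup V(H^w)$; for $d\ge 3$, $$N_H(u_1)=\{v,u_2\}\cup V(H^v)\cup V(\mathcal{H}_1)\cup V(\mathcal{H}_{1,2}),$$ $$N_H(u_{d-1})=\{w,u_{d-2}\}\cup V(H^w)\cup V(\mathcal{H}_{d-1})\cup V(\mathcal{H}_{d-2,d-1}),$$ $$N_H(u_i)=\{u_{i-1},u_{i+1}\}\cup V(\mathcal{H}_{i})\cup V(\mathcal{H}_{i-1,i})\cup V(\mathcal{H}_{i,i+1})\quad (2\le i\le d-2),$$ while for $d=2$, $N_H(u_1)=\{v,w\}\cup V(H^v)\cup V(H^w)\cup V(\mathcal{H}_1)$; and the induced subgraph of $H$ on the set of all vertices outside $\{v,u_1,\ldots,u_{d-1},w\}$ is the disjoint union of $H^v$, $H^w$ and all the complete graphs that are members of the families $\mathcal{H}_i$ and $\mathcal{H}_{j,j+1}$. Then $\mathcal{G}_d$ is the family of all graphs $H$ obtained in this way. The family $\mathcal{F}_q$ ($q\ge 2$ an integer). The join $H_1*H_2$ of graphs on disjoint vertex sets has vertex set $V(H_1)\cup V(H_2)$ and edge set $E(H_1)\cup E(H_2)\cup\{\{x,y\}: x\in V(H_1), y\in V(H_2)\}$. $\mathcal{F}_q$ consists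 of all graphs $K_q*(F_1\cup\cdots\cup F_p)$ with $p\ge 2$, where each $F_i$ is a complete graph isomorphic to $K_{\ell_i}$ with $\ell_i\ge 1$, and the $F_i$ have pairwise disjoint vertex sets (so $F_1\cup\cdots\cup F_p$ is their disjoint union). *)

theory Defs
  imports "Graph_Theory.Graph_Theory"
begin

text \<open>
  A finite simple graph is a \<^locale>\<open>pair_graph\<close>: a finite vertex set with a symmetric
  loop-free set of arcs, each undirected edge being represented by its two arcs.
\<close>

definition nbrs :: "'a pair_pre_digraph \<Rightarrow> 'a \<Rightarrow> 'a set" where
  "nbrs G x = {y. (x, y) \<in> parcs G}"

definition free_verts :: "'a pair_pre_digraph \<Rightarrow> 'a set" where
  "free_verts G = {x \<in> pverts G. \<forall>y\<in>nbrs G x. \<forall>z\<in>nbrs G x. y \<noteq> z \<longrightarrow> (y, z) \<in> parcs G}"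

definition num_free :: "'a pair_pre_digraph \<Rightarrow> nat" where
  "num_free G = card (free_verts G)"

text \<open>The distance is unspecified for vertices that are not joined by a walk.\<close>

definition gdist :: "'a pair_pre_digraph \<Rightarrow> 'a \<Rightarrow> 'a \<Rightarrow> nat" where
  "gdist G u v = (LEAST k. \<exists>p. pre_digraph.awalk (with_proj G) u p v \<and> length p = k)"

definition diam :: "'a pair_pre_digraph \<Rightarrow> nat" where
  "diam G = Max {gdist G u v | u v. u \<in> pverts G \<and> v \<in> pverts G}"

text \<open>
  The library's connectedness excludes the graph without vertices; \<open>T\<close> is a proper subset so that
  removing all vertices does not count as disconnecting the graph. For a complete graph there
  is no such \<open>T\<close> and the value is unspecified.
\<close>

definition vertex_connectivity :: "'a pair_pre_digraph \<Rightarrow> nat" where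
  "vertex_connectivity G =
    (LEAST k. \<exists>T. T \<subset> pverts G \<and> card T = k \<and>
      \<not> Digraph_Component.connected (with_proj G \<restriction> (pverts G - T)))"

definition verts_of :: "'a pair_pre_digraph list \<Rightarrow> 'a set" where
  "verts_of Cs = (\<Union>C\<in>set Cs. pverts C)"

definition graph_union :: "'a pair_pre_digraph list \<Rightarrow> 'a pair_pre_digraph" where
  "graph_union Cs = \<lparr>pverts = verts_of Cs, parcs = (\<Union>C\<in>set Cs. parcs C)\<rparr>"

definition pairwise_disjoint_verts :: "'a pair_pre_digraph list \<Rightarrow> bool" where
  "pairwise_disjoint_verts Cs \<longleftrightarrow> sorted_wrt (\<lambda>A B. pverts A \<inter> pverts B = {}) Cs"

definition graph_join :: "'a pair_pre_digraph \<Rightarrow> 'a pair_pre_digraph \<Rightarrow> 'a pair_pre_digraph" where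
  "graph_join A B =
    \<lparr>pverts = pverts A \<union> pverts B,
     parcs = parcs A \<union> parcs B \<union> pverts A \<times> pverts B \<union> pverts B \<times> pverts A\<rparr>"

text \<open>
  The path \<open>v, u\<^sub>1, \<dots>, u\<^bsub>d-1\<^esub>, w\<close> is \<open>u 0, \<dots>, u d\<close>. A finite family of complete graphs is
  a list of graphs: \<open>Hs i\<close> is the family attached to \<open>u i\<close> alone, and \<open>Js j\<close> is the family
  \<open>\<H>\<^bsub>j,j+1\<^esub>\<close> attached to both \<open>u j\<close> and \<open>u (j + 1)\<close>.
\<close>

definition built_\<G> :: "nat \<Rightarrow> 'a pair_pre_digraph \<Rightarrow> bool" where
  "built_\<G> d H \<longleftrightarrow> 2 \<le> d \<and> pair_graph H \<and>
    (\<exists>(u :: nat \<Rightarrow> 'a) Hv Hw Hs Js.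
      let P = u ` {0..d};
          Cs = Hv # Hw # concat (map Hs [1..<d]) @ concat (map Js [1..<d - 1])
      in inj_on u {0..d} \<and>
         (\<forall>C\<in>set Cs. \<exists>m. complete_digraph m (with_proj C)) \<and>
         pairwise_disjoint_verts Cs \<and>
         P \<inter> verts_of Cs = {} \<and>
         pverts H = P \<union> verts_of Cs \<and>
         nbrs H (u 0) = {u 1} \<union> pverts Hv \<and>
         nbrs H (u d) = {u (d - 1)} \<union> pverts Hw \<and>
         (3 \<le> d \<longrightarrow>
           nbrs H (u 1) = {u 0, u 2} \<union> pverts Hv \<union> verts_of (Hs 1) \<union> verts_of (Js 1) \<and>
           nbrs H (u (d - 1)) =
             {u d, u (d - 2)} \<union> pverts Hw \<union> verts_of (Hs (d - 1)) \<union> verts_of (Js (d - 2)) \<and>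
           (\<forall>i\<in>{2..d - 2}. nbrs H (u i) =
             {u (i - 1), u (i + 1)} \<union> verts_of (Hs i) \<union> verts_of (Js (i - 1)) \<union> verts_of (Js i))) \<and>
         (d = 2 \<longrightarrow>
           nbrs H (u 1) = {u 0, u 2} \<union> pverts Hv \<union> pverts Hw \<union> verts_of (Hs 1)) \<and>
         with_proj H \<restriction> (pverts H - P) = with_proj (graph_union Cs))"

definition built_\<F> :: "nat \<Rightarrow> 'a pair_pre_digraph \<Rightarrow> bool" where
  "built_\<F> q H \<longleftrightarrow> 2 \<le> q \<and>
    (\<exists>K Fs. complete_digraph q (with_proj K) \<and>
      2 \<le> length Fs \<and>
      (\<forall>F\<in>set Fs. \<exists>l\<ge>1. complete_digraph l (with_proj F)) \<and>
      pairwise_disjoint_verts (K # Fs) \<and>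
      H = graph_join K (graph_union Fs))"

definition family_\<G> :: "nat \<Rightarrow> 'a pair_pre_digraph set" where
  "family_\<G> d = {G. \<exists>H :: 'a pair_pre_digraph. built_\<G> d H \<and> digraph_iso (with_proj H) (with_proj G)}"

definition family_\<F> :: "nat \<Rightarrow> 'a pair_pre_digraph set" where
  "family_\<F> q = {G. \<exists>H :: 'a pair_pre_digraph. built_\<F> q H \<and> digraph_iso (with_proj H) (with_proj G)}"

end

theory Submission
  imports Defs
begin

text \<open>
  Let \<open>v\<close> and \<open>w\<close> be vertices at distance \<open>d = diam G\<close>. For each \<open>0 < i < d\<close> the nonfree vertices at
  distance \<open>i\<close> from \<open>v\<close> separate \<open>v\<close> from \<open>w\<close>, so there are at least \<open>\<kappa>\<close> of them and
  \<open>n - f \<ge> (d - 1) \<kappa>\<close>. Since \<open>(d - 1) \<kappa> - (d + \<kappa> - 2) = (d - 2) (\<kappa> - 1)\<close>, the equality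
  \<open>n - f = d + \<kappa> - 2\<close> forces \<open>\<kappa> = 1\<close> or \<open>d = 2\<close>. For \<open>\<kappa> = 1\<close> the nonfree vertices are the inner
  vertices of a geodesic, and adjacent free vertices have the same closed neighbourhood, which gives
  the cliques of \<open>\<G>\<^sub>d\<close>. For \<open>\<kappa> \<ge> 2\<close> there are exactly \<open>\<kappa>\<close> nonfree vertices, all of them adjacent to
  every free vertex, which gives the join of \<open>\<F>\<^sub>\<kappa>\<close>. Conversely, the nonfree vertices of the members
  of both families can be counted directly.
\<close>

section \<open>Lists of complete graphs, and splitting a vertex set into cliques\<close>

definition complete_on :: "'a set \<Rightarrow> 'a pair_pre_digraph" where
  "complete_on C = \<lparr>pverts = C, parcs = {(x, y). x \<in> C \<and> y \<in> C \<and> x \<noteq> y}\<rparr>"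

definition arcs_of :: "'a pair_pre_digraph list \<Rightarrow> 'a rel" where
  "arcs_of Cs = (\<Union>C\<in>set Cs. parcs C)"

lemma complete_on_simps [simp]:
  "pverts (complete_on C) = C"
  "parcs (complete_on C) = {(x, y). x \<in> C \<and> y \<in> C \<and> x \<noteq> y}"
  by (simp_all add: complete_on_def)

lemma complete_digraph_complete_on:
  "finite C \<Longrightarrow> complete_digraph (card C) (with_proj (complete_on C))"
  by (simp add: complete_digraph_pair_def)

lemma verts_of_simps [simp]:
  "verts_of [] = {}"
  "verts_of (C # Cs) = pverts C \<union> verts_of Cs"
  "verts_of (Cs @ Ds) = verts_of Cs \<union> verts_of Ds"
  "verts_of (concat Ls) = (\<Union>L\<in>set Ls. verts_of L)"
  by (auto simp: verts_of_def)

lemma arcs_of_simps [simp]: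
  "arcs_of [] = {}"
  "arcs_of (C # Cs) = parcs C \<union> arcs_of Cs"
  "arcs_of (Cs @ Ds) = arcs_of Cs \<union> arcs_of Ds"
  "arcs_of (concat Ls) = (\<Union>L\<in>set Ls. arcs_of L)"
  by (auto simp: arcs_of_def)

lemma graph_union_eq: "graph_union Cs = \<lparr>pverts = verts_of Cs, parcs = arcs_of Cs\<rparr>"
  by (simp add: graph_union_def arcs_of_def)

lemma pairwise_disjoint_verts_simps [simp]:
  "pairwise_disjoint_verts []"
  "pairwise_disjoint_verts (C # Cs) \<longleftrightarrow>
    pverts C \<inter> verts_of Cs = {} \<and> pairwise_disjoint_verts Cs"
  "pairwise_disjoint_verts (Cs @ Ds) \<longleftrightarrow>
    pairwise_disjoint_verts Cs \<and> pairwise_disjoint_verts Ds \<and> verts_of Cs \<inter> verts_of Ds = {}"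
  by (auto simp: pairwise_disjoint_verts_def sorted_wrt_append verts_of_def)

lemma pairwise_disjoint_verts_concat_map:
  assumes "\<And>i. pairwise_disjoint_verts (f i)"
    and "\<And>i j. i < j \<Longrightarrow> verts_of (f i) \<inter> verts_of (f j) = {}"
  shows "pairwise_disjoint_verts (concat (map f [a..<b]))"
proof (induction b)
  case (Suc b)
  have "(\<Union>i\<in>{a..<b}. verts_of (f i)) \<inter> verts_of (f b) = {}"
    using assms(2) by fastforce
  then show ?case using Suc assms(1) by auto
qed simp

text \<open>A symmetric, irreflexive relation that is transitive off the diagonal becomes an
  equivalence once the diagonal is added; its classes are the cliques, split off one closed
  neighbourhood at a time. It is applied to sets of free vertices, where transitivity is freeness of
  the middle vertex. The bound \<open>l \<ge> 1\<close> is what \<open>built_\<F>\<close> asks of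
  its cliques.\<close>

lemma clique_partition:
  assumes "finite X"
    and "\<And>x y. (x, y) \<in> E \<Longrightarrow> (y, x) \<in> E" "\<And>x. (x, x) \<notin> E"
    and "\<And>x y z. x \<in> X \<Longrightarrow> y \<in> X \<Longrightarrow> z \<in> X \<Longrightarrow> (x, y) \<in> E \<Longrightarrow> (y, z) \<in> E \<Longrightarrow> x \<noteq> z \<Longrightarrow> (x, z) \<in> E"
  shows "\<exists>L. pairwise_disjoint_verts L \<and> (\<forall>C\<in>set L. \<exists>l\<ge>1. complete_digraph l (with_proj C)) \<and>
    verts_of L = X \<and> arcs_of L = E \<inter> X \<times> X"
  using assms(1,4)
proof (induction X rule: finite_psubset_induct)
  case (psubset X)
  show ?case
  proof (cases "X = {}")
    case True
    then show ?thesis by (intro exI[of _ "[]"]) simp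
  next
    case False
    then obtain x where x: "x \<in> X" by blast
    define C where "C = {y \<in> X. y = x \<or> (x, y) \<in> E}"
    have C: "C \<subseteq> X" "x \<in> C" by (auto simp: C_def x)
    then have "X - C \<subset> X" using x by blast
    then obtain L where L: "pairwise_disjoint_verts L"
      "\<forall>C\<in>set L. \<exists>l\<ge>1. complete_digraph l (with_proj C)"
      "verts_of L = X - C" "arcs_of L = E \<inter> (X - C) \<times> (X - C)"
      using psubset.IH[of "X - C"] psubset.prems by blast
    have fin: "finite C" using psubset.hyps C finite_subset by blast
    then have "1 \<le> card C" using C by (auto simp: Suc_le_eq card_gt_0_iff)
    then have "\<exists>l\<ge>1. complete_digraph l (with_proj (complete_on C))"
      using complete_digraph_complete_on[OF fin] by blast
    moreover have "parcs (complete_on C) = E \<inter> C \<times> C"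
    proof (intro set_eqI iffI)
      fix p assume "p \<in> parcs (complete_on C)"
      then obtain y z where "p = (y, z)" "y \<in> C" "z \<in> C" "y \<noteq> z" by auto
      then show "p \<in> E \<inter> C \<times> C"
        using assms(2) psubset.prems[of y x z] x unfolding C_def by auto
    qed (use assms(3) in auto)
    \<comment> \<open>An edge leaving \<open>C\<close> would make its outer end adjacent to
      \<open>x\<close>, hence a member of \<open>C\<close>.\<close>
    moreover have "(y, z) \<notin> E" "(z, y) \<notin> E" if "y \<in> C" "z \<in> X - C" for y z
      using that assms(2) psubset.prems[of x y z] x unfolding C_def by blast+
    then have "E \<inter> X \<times> X = E \<inter> C \<times> C \<union> E \<inter> (X - C) \<times> (X - C)"
      using C by blast
    ultimately show ?thesis
      using L C by (intro exI[of _ "complete_on C # L"]) auto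
  qed
qed

section \<open>Walks as relation powers, distance, connectivity and free vertices\<close>

context pair_graph
begin

text \<open>Reduces distances to powers of the arc relation. The conjunct on \<open>u\<close> is
  needed at \<open>k = 0\<close>: an empty walk must sit at a vertex, while the zeroth power relates
  everything to itself.\<close>

lemma awalk_length_iff_relpow:
  "(\<exists>p. awalk u p v \<and> length p = k) \<longleftrightarrow> u \<in> pverts G \<and> (u, v) \<in> parcs G ^^ k"
proof (induction k arbitrary: u)
  case 0
  then show ?case by (auto simp: awalk_Nil_iff)
next
  case (Suc k)
  have "(\<exists>p. awalk u p v \<and> length p = Suc k) \<longleftrightarrow>
    (\<exists>y. (u, y) \<in> parcs G \<and> (\<exists>p. awalk y p v \<and> length p = k))" (is "?L \<longleftrightarrow> ?R")
  proof
    assume ?L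
    then obtain e p where "awalk u (e # p) v" "length p = k"
      by (metis length_Suc_conv)
    then show ?R by (cases e) (auto simp: awalk_Cons_iff)
  next
    assume ?R
    then obtain y p where "(u, y) \<in> parcs G" "awalk y p v" "length p = k" by blast
    then show ?L by (intro exI[of _ "(u, y) # p"]) (simp add: awalk_Cons_iff)
  qed
  then show ?case
    unfolding Suc.IH by (metis in_arcsD1 in_arcsD2 relpow_Suc_D2 relpow_Suc_I2)
qed

lemma gdist_eq: "u \<in> pverts G \<Longrightarrow> gdist G u v = (LEAST k. (u, v) \<in> parcs G ^^ k)"
  by (simp add: gdist_def awalk_length_iff_relpow)

lemma gdist_le: "u \<in> pverts G \<Longrightarrow> (u, v) \<in> parcs G ^^ k \<Longrightarrow> gdist G u v \<le> k"
  by (simp add: gdist_eq Least_le)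

lemma gdist_refl: "u \<in> pverts G \<Longrightarrow> gdist G u u = 0"
  using gdist_le[of u u 0] by simp

text \<open>Arcs come in both directions, so \<open>mk_symmetric\<close> adds nothing, and
  \<open>rtrancl_on S\<close> agrees with the ordinary closure as soon as the starting point is in
  \<open>S\<close>.\<close>

lemma connected_induced_iff:
  assumes "S \<subseteq> pverts G"
  shows "connected (with_proj G \<restriction> S) \<longleftrightarrow>
    S \<noteq> {} \<and> (\<forall>x\<in>S. \<forall>y\<in>S. (x, y) \<in> (parcs G \<inter> S \<times> S)\<^sup>*)"
proof -
  let ?R = "parcs G \<inter> S \<times> S"
  have *: "parcs (mk_symmetric (with_proj G \<restriction> S)) = ?R"
    by (auto simp: parcs_mk_symmetric dest: arcs_symmetric)
  have "(x, y) \<in> rtrancl_on S ?R \<longleftrightarrow> (x, y) \<in> ?R\<^sup>*" if "x \<in> S" for x y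
  proof
    show "(x, y) \<in> rtrancl_on S ?R" if "(x, y) \<in> ?R\<^sup>*"
      using that by (induction rule: rtrancl_induct)
        (use \<open>x \<in> S\<close> in \<open>auto intro: rtrancl_on_into_rtrancl_on\<close>)
  qed (rule rtrancl_on_rtranclI)
  then show ?thesis
    by (auto simp: connected_def strongly_connected_def reachable_def *)
qed

lemma connected_iff:
  "connected (with_proj G) \<longleftrightarrow>
    pverts G \<noteq> {} \<and> (\<forall>x\<in>pverts G. \<forall>y\<in>pverts G. (x, y) \<in> (parcs G)\<^sup>*)"
proof -
  have "with_proj G \<restriction> pverts G = with_proj G"
    by (auto simp: with_proj_def induce_subgraph_def dest: in_arcsD1 in_arcsD2)
  moreover have "parcs G \<inter> pverts G \<times> pverts G = parcs G"
    by (auto dest: in_arcsD1 in_arcsD2)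
  ultimately show ?thesis
    using connected_induced_iff[of "pverts G"] by simp
qed

lemma vertex_connectivity_le:
  assumes "T \<subset> pverts G" "x \<in> pverts G - T" "y \<in> pverts G - T"
    and "(x, y) \<notin> (parcs G \<inter> (pverts G - T) \<times> (pverts G - T))\<^sup>*"
  shows "vertex_connectivity G \<le> card T"
  unfolding vertex_connectivity_def
  using assms connected_induced_iff[of "pverts G - T"]
  by (intro Least_le exI[of _ T]) auto

text \<open>Deleting everything except the nonadjacent \<open>x\<close> and \<open>y\<close>
  disconnects the graph, so the \<open>LEAST\<close> is attained by some \<open>T\<close>;
  connectedness of \<open>G\<close> excludes \<open>T = {}\<close>.\<close>

lemma vertex_connectivity_pos:
  assumes "connected (with_proj G)" "x \<in> pverts G" "y \<in> pverts G" "x \<noteq> y" "(x, y) \<notin> parcs G"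
  shows "1 \<le> vertex_connectivity G"
proof -
  let ?P = "\<lambda>k. \<exists>T. T \<subset> pverts G \<and> card T = k \<and>
    \<not> connected (with_proj G \<restriction> (pverts G - T))"
  let ?T = "pverts G - {x, y}"
  have "pverts G - ?T = {x, y}" using assms by auto
  moreover have "parcs G \<inter> {x, y} \<times> {x, y} = {}"
    using assms arcs_symmetric[of y x] no_loops'[of x x] no_loops'[of y y] by blast
  ultimately have "\<not> connected (with_proj G \<restriction> (pverts G - ?T))"
    using connected_induced_iff[of "{x, y}"] assms by simp
  moreover have "?T \<subset> pverts G" using assms(2) by blast
  ultimately have "?P (card ?T)" by metis
  then have "?P (vertex_connectivity G)"
    unfolding vertex_connectivity_def by (rule LeastI[of ?P])
  then obtain T where T: "T \<subset> pverts G" "card T = vertex_connectivity G"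
    "\<not> connected (with_proj G \<restriction> (pverts G - T))" by blast
  have "T \<noteq> {}"
  proof
    assume "T = {}"
    moreover have "parcs G \<inter> pverts G \<times> pverts G = parcs G"
      by (auto dest: in_arcsD1 in_arcsD2)
    ultimately show False
      using T connected_induced_iff[of "pverts G"] assms(1) connected_iff by simp
  qed
  then have "card T \<noteq> 0"
    using T pair_finite_verts finite_subset by fastforce
  then show ?thesis using T by simp
qed

lemma free_verts_iff:
  "x \<in> free_verts G \<longleftrightarrow> x \<in> pverts G \<and>
    (\<forall>y z. (x, y) \<in> parcs G \<longrightarrow> (x, z) \<in> parcs G \<longrightarrow> y \<noteq> z \<longrightarrow> (y, z) \<in> parcs G)"
  by (auto simp: free_verts_def nbrs_def)

lemma free_verts_subset: "free_verts G \<subseteq> pverts G"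
  by (auto simp: free_verts_def)

lemma card_nonfree: "card (pverts G - free_verts G) + num_free G = card (pverts G)"
  unfolding num_free_def
  by (metis add.commute card_Diff_subset card_mono free_verts_subset le_add_diff_inverse
      pair_finite_verts rev_finite_subset)

section \<open>Distance layers, diameter and geodesics of a connected graph\<close>

context
  assumes conn: "connected (with_proj G)"
begin

lemma gdist_relpow:
  assumes "u \<in> pverts G" "v \<in> pverts G"
  shows "(u, v) \<in> parcs G ^^ gdist G u v"
proof -
  have "\<exists>k. (u, v) \<in> parcs G ^^ k"
    using conn assms connected_iff rtrancl_power by metis
  then show ?thesis
    unfolding gdist_eq[OF assms(1)] by (metis LeastI)
qed

lemma gdist_Suc:
  assumes "v \<in> pverts G" "(x, y) \<in> parcs G"
  shows "gdist G v y \<le> Suc (gdist G v x)"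
  using assms gdist_relpow[OF assms(1) in_arcsD1[OF assms(2)]] by (blast intro: gdist_le relpow_Suc_I)

text \<open>
  A shortest walk from \<open>v\<close> to \<open>w\<close> avoiding the nonfree vertices at distance \<open>i\<close> is an induced
  path, so its inner vertices are nonfree, yet it has to cross distance \<open>i\<close>.
\<close>

lemma card_nonfree_layer:
  assumes v: "v \<in> pverts G" and w: "w \<in> pverts G" and i: "0 < i" "i < gdist G v w"
  shows "vertex_connectivity G \<le> card {x \<in> pverts G - free_verts G. gdist G v x = i}"
proof (rule vertex_connectivity_le)
  let ?T = "{x \<in> pverts G - free_verts G. gdist G v x = i}"
  let ?S = "pverts G - ?T"
  let ?R = "parcs G \<inter> ?S \<times> ?S"
  show vS: "v \<in> ?S" and wS: "w \<in> ?S" using v w i gdist_refl[of v] by auto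
  then show "?T \<subset> pverts G" by blast
  show "(v, w) \<notin> ?R\<^sup>*"
  proof
    assume "(v, w) \<in> ?R\<^sup>*"
    then have ex: "\<exists>k. (v, w) \<in> ?R ^^ k" unfolding rtrancl_power .
    \<comment> \<open>A walk of minimal length avoiding \<open>?T\<close> has neither chords nor
      repetitions, since either would give a shorter one.\<close>
    define k where "k = (LEAST k. (v, w) \<in> ?R ^^ k)"
    have k: "(v, w) \<in> ?R ^^ k" unfolding k_def using ex by (rule LeastI_ex)
    have min: "k \<le> l" if "(v, w) \<in> ?R ^^ l" for l
      unfolding k_def using that by (rule Least_le)
    obtain p where p: "p 0 = v" "p k = w" "\<And>j. j < k \<Longrightarrow> (p j, p (Suc j)) \<in> ?R"
      using k unfolding relpow_fun_conv by blast
    have pre: "(v, p j) \<in> ?R ^^ j" if "j \<le> k" for j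
      unfolding relpow_fun_conv using p that by (intro exI[of _ p]) auto
    have post: "(p j, w) \<in> ?R ^^ (k - j)" if "j \<le> k" for j
      unfolding relpow_fun_conv using p that by (intro exI[of _ "\<lambda>m. p (j + m)"]) auto
    \<comment> \<open>\<open>p j\<close> is the first vertex at distance at least \<open>i\<close>.
      Distance grows by at most one along an arc, so it equals \<open>i\<close> there; as
      \<open>j\<close> is neither \<open>0\<close> nor \<open>k\<close>, \<open>p j\<close> has a
      predecessor \<open>p m\<close> and a successor on the walk.\<close>
    define j where "j = (LEAST j. i \<le> gdist G v (p j))"
    have j: "i \<le> gdist G v (p j)"
      unfolding j_def by (rule LeastI[of _ k]) (use i p in simp)
    have jl: "gdist G v (p m) < i" if "m < j" for m
      using not_less_Least[of m "\<lambda>j. i \<le> gdist G v (p j)"] that unfolding j_def by simp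
    have jk: "j \<le> k"
      unfolding j_def by (rule Least_le) (use i p in simp)
    have "j \<noteq> 0" using j p i gdist_refl[OF v] by (metis not_le)
    then obtain m where m: "j = Suc m" by (cases j) auto
    have "(p m, p j) \<in> parcs G" using p(3)[of m] m jk by auto
    then have "gdist G v (p j) \<le> Suc (gdist G v (p m))" by (rule gdist_Suc[OF v])
    with jl[of m] m j have ji: "gdist G v (p j) = i" by simp
    then have "j \<noteq> k" using p i by auto
    with jk have jlt: "j < k" by simp
    have e1: "(p m, p j) \<in> ?R" using p(3)[of m] m jk by auto
    have e2: "(p j, p (Suc j)) \<in> ?R" using p(3) jlt by blast
    have "(p m, p (Suc j)) \<notin> ?R"
    proof
      assume "(p m, p (Suc j)) \<in> ?R"
      then have "(v, p (Suc j)) \<in> ?R ^^ j" using pre[of m] m jk by auto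
      then have "(v, w) \<in> ?R ^^ (j + (k - Suc j))"
        using post[of "Suc j"] jlt unfolding relpow_add by auto
      then show False using min jlt by fastforce
    qed
    moreover have "p m \<noteq> p (Suc j)"
    proof
      assume eq: "p m = p (Suc j)"
      then have "(v, w) \<in> ?R ^^ (m + (k - Suc j))"
        using pre[of m] post[of "Suc j"] jlt m unfolding relpow_add by auto
      then show False using min jlt m by fastforce
    qed
    \<comment> \<open>Both \<open>p m\<close> and \<open>p (Suc j)\<close> lie in \<open>?S\<close>,
      so not being joined in \<open>?R\<close> means not being joined in \<open>G\<close>. Thus
      \<open>p j\<close> is nonfree at distance \<open>i\<close>, that is, in
      \<open>?T\<close>.\<close>
    ultimately have "p j \<notin> free_verts G"
      using e1 e2 arcs_symmetric unfolding free_verts_iff by blast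
    then show False using e1 ji by blast
  qed
qed

text \<open>The layers strictly between \<open>v\<close> and \<open>w\<close> are disjoint, and each
  contributes at least \<open>vertex_connectivity G\<close>.\<close>

lemma card_nonfree_ge:
  assumes v: "v \<in> pverts G" and w: "w \<in> pverts G"
  shows "(gdist G v w - 1) * vertex_connectivity G \<le> card (pverts G - free_verts G)"
proof -
  let ?L = "\<lambda>i. {x \<in> pverts G - free_verts G. gdist G v x = i}"
  let ?I = "{1..<gdist G v w}"
  have "(gdist G v w - 1) * vertex_connectivity G = (\<Sum>i\<in>?I. vertex_connectivity G)"
    by simp
  also have "\<dots> \<le> (\<Sum>i\<in>?I. card (?L i))"
    by (intro sum_mono card_nonfree_layer[OF v w]) auto
  also have "\<dots> = card (\<Union>i\<in>?I. ?L i)"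
    using pair_finite_verts by (intro card_UN_disjoint[symmetric]) auto
  also have "\<dots> \<le> card (pverts G - free_verts G)"
    using pair_finite_verts by (intro card_mono) auto
  finally show ?thesis .
qed

lemma diam_attained:
  obtains v w where "v \<in> pverts G" "w \<in> pverts G" "gdist G v w = diam G"
proof -
  let ?D = "{gdist G u v | u v. u \<in> pverts G \<and> v \<in> pverts G}"
  have D: "?D = (\<lambda>(u, v). gdist G u v) ` (pverts G \<times> pverts G)" by auto
  then have "finite ?D" using pair_finite_verts by simp
  moreover have "?D \<noteq> {}" unfolding D using conn connected_iff by simp
  ultimately have "diam G \<in> ?D" unfolding diam_def by (rule Max_in)
  then show ?thesis using that by auto
qed

lemma gdist_le_diam:
  assumes "v \<in> pverts G" "w \<in> pverts G"
  shows "gdist G v w \<le> diam G"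
proof -
  let ?D = "{gdist G u v | u v. u \<in> pverts G \<and> v \<in> pverts G}"
  have "?D = (\<lambda>(u, v). gdist G u v) ` (pverts G \<times> pverts G)" by auto
  then have "finite ?D" using pair_finite_verts by simp
  then show ?thesis unfolding diam_def using assms by (intro Max_ge) auto
qed

lemma gdist_ge_2:
  assumes "v \<in> pverts G" "w \<in> pverts G" "v \<noteq> w" "(v, w) \<notin> parcs G"
  shows "2 \<le> gdist G v w"
proof (rule ccontr)
  assume "\<not> 2 \<le> gdist G v w"
  then have "gdist G v w = 0 \<or> gdist G v w = 1" by auto
  then show False using gdist_relpow[of v w] assms by auto
qed

text \<open>Any two vertices are joined through \<open>c\<close> by at most two steps, and the
  nonadjacent pair needs two.\<close>

lemma diam_eq_2:
  assumes "c \<in> pverts G" "\<And>x. x \<in> pverts G \<Longrightarrow> x \<noteq> c \<Longrightarrow> (c, x) \<in> parcs G"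
    and "v \<in> pverts G" "w \<in> pverts G" "v \<noteq> w" "(v, w) \<notin> parcs G"
  shows "diam G = 2"
proof (rule antisym)
  obtain x y where xy: "x \<in> pverts G" "y \<in> pverts G" "gdist G x y = diam G"
    by (rule diam_attained)
  have c: "gdist G x c \<le> 1"
    using xy(1) assms(2)[of x] arcs_symmetric[of c x] gdist_refl[of c] gdist_le[of x c 1]
    by (cases "x = c") auto
  show "diam G \<le> 2"
  proof (cases "y = c")
    case False
    then show ?thesis
      using gdist_Suc[OF xy(1) assms(2)[OF xy(2)]] c xy by simp
  qed (use c xy in simp)
  show "2 \<le> diam G"
    using gdist_ge_2[OF assms(3-6)] gdist_le_diam[OF assms(3,4)] by simp
qed

text \<open>On a shortest walk \<open>u i\<close> has distance exactly \<open>i\<close> from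
  \<open>v\<close>. Hence \<open>gdist G v\<close> inverts \<open>u\<close>, and an arc can only
  join consecutive indices.\<close>

lemma geodesic:
  assumes "v \<in> pverts G" "w \<in> pverts G"
  obtains u where "u 0 = v" "u (gdist G v w) = w"
    "inj_on u {0..gdist G v w}" "u ` {0..gdist G v w} \<subseteq> pverts G"
    "\<And>i j. i \<le> gdist G v w \<Longrightarrow> j \<le> gdist G v w \<Longrightarrow>
      (u i, u j) \<in> parcs G \<longleftrightarrow> j = Suc i \<or> i = Suc j"
proof -
  let ?d = "gdist G v w"
  obtain u where u: "u 0 = v" "u ?d = w" "\<And>i. i < ?d \<Longrightarrow> (u i, u (Suc i)) \<in> parcs G"
    using gdist_relpow[OF assms] unfolding relpow_fun_conv by metis
  have V: "u i \<in> pverts G" if "i \<le> ?d" for i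
    using that u(3)[of i] u(2) assms(2) in_arcsD1 by (cases "i = ?d") auto
  have pre: "(v, u i) \<in> parcs G ^^ i" if "i \<le> ?d" for i
    unfolding relpow_fun_conv using u(1,3) that by (intro exI[of _ u]) auto
  have post: "(u i, w) \<in> parcs G ^^ (?d - i)" if "i \<le> ?d" for i
    unfolding relpow_fun_conv using u(2,3) that by (intro exI[of _ "\<lambda>m. u (i + m)"]) auto
  have dist: "gdist G v (u i) = i" if i: "i \<le> ?d" for i
  proof -
    have "gdist G v (u i) \<le> i" using gdist_le[OF assms(1) pre[OF i]] .
    \<comment> \<open>A shorter walk to \<open>u i\<close>, continued along the path, would reach
      \<open>w\<close> in fewer than \<open>?d\<close> steps.\<close>
    moreover have "(v, w) \<in> parcs G ^^ (gdist G v (u i) + (?d - i))"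
      using gdist_relpow[OF assms(1) V[OF i]] post[OF i] unfolding relpow_add by auto
    then have "?d \<le> gdist G v (u i) + (?d - i)" using gdist_le[OF assms(1)] by blast
    ultimately show ?thesis using i by simp
  qed
  have "(u i, u j) \<in> parcs G \<longleftrightarrow> j = Suc i \<or> i = Suc j" if ij: "i \<le> ?d" "j \<le> ?d" for i j
  proof
    assume e: "(u i, u j) \<in> parcs G"
    then have "i \<noteq> j" using no_loops' by blast
    moreover have "j \<le> Suc i" "i \<le> Suc j"
      using gdist_Suc[OF assms(1) e] gdist_Suc[OF assms(1) arcs_symmetric[OF e]] dist ij by auto
    ultimately show "j = Suc i \<or> i = Suc j" by linarith
  next
    assume "j = Suc i \<or> i = Suc j"
    then show "(u i, u j) \<in> parcs G"
    proof
      assume "j = Suc i" with u(3)[of i] ij show ?thesis by simp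
    next
      assume "i = Suc j" with u(3)[of j] ij arcs_symmetric show ?thesis by simp
    qed
  qed
  moreover have "inj_on u {0..?d}" by (rule inj_on_inverseI[where g = "gdist G v"]) (simp add: dist)
  moreover have "u ` {0..?d} \<subseteq> pverts G" using V by auto
  ultimately show ?thesis by (intro that[OF u(1,2)])
qed

end

end

section \<open>Recognising members of the two families by their nonfree vertices\<close>

context pair_graph
begin

text \<open>Freeness of \<open>x\<close> joins \<open>y\<close> to every other neighbour of
  \<open>x\<close>, and vice versa: adjacent free vertices have equal closed neighbourhoods.\<close>

lemma free_twins:
  assumes "x \<in> free_verts G" "y \<in> free_verts G" "(x, y) \<in> parcs G" "z \<noteq> x" "z \<noteq> y"
  shows "(x, z) \<in> parcs G \<longleftrightarrow> (y, z) \<in> parcs G"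
  using assms arcs_symmetric[of x y] arcs_symmetric[of y x] unfolding free_verts_iff by metis

text \<open>If all neighbours of \<open>x\<close> were free, they would share its closed
  neighbourhood, so no walk from \<open>x\<close> could leave that set and \<open>c\<close> would be
  free.\<close>

lemma free_adjacent_nonfree:
  assumes conn: "connected (with_proj G)" and x: "x \<in> free_verts G"
    and c: "c \<in> pverts G - free_verts G"
  shows "\<exists>y \<in> pverts G - free_verts G. (x, y) \<in> parcs G"
proof (rule ccontr)
  assume no: "\<not> ?thesis"
  have "(x, c) \<in> (parcs G)\<^sup>*"
    using conn x c free_verts_subset unfolding connected_iff by blast
  then have "c = x \<or> (x, c) \<in> parcs G"
  proof (induction rule: rtrancl_induct)
    case (step y z)
    show ?case
    proof (cases "y = x")
      case False
      then have "(x, y) \<in> parcs G" using step by simp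
      moreover from this no have "y \<in> free_verts G" using in_arcsD2 by blast
      ultimately show ?thesis
        using free_twins[OF x, of y z] step no_loops'[of y y] by blast
    qed (use step in simp)
  qed simp
  then show False using no x c by blast
qed

text \<open>Every vertex off the path is free and is sorted by the path vertices it sees. These form
  a clique of an induced path, so they are one vertex or two consecutive ones. By
  \<open>free_twins\<close>, adjacent vertices off the path see the same path vertices, so every
  class is a disjoint union of cliques.\<close>

lemma built_\<G>I:
  assumes conn: "connected (with_proj G)" and d: "2 \<le> d"
    and inj: "inj_on u {0..d}" and uV: "u ` {0..d} \<subseteq> pverts G"
    and adj: "\<And>i j. i \<le> d \<Longrightarrow> j \<le> d \<Longrightarrow> (u i, u j) \<in> parcs G \<longleftrightarrow> j = Suc i \<or> i = Suc j"
    and nonfree: "pverts G - free_verts G = u ` {1..<d}"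
  shows "built_\<G> d G"
proof -
  define P where "P = u ` {0..d}"
  define X where "X = pverts G - P"
  define A where "A x = {i. 1 \<le> i \<and> i < d \<and> (x, u i) \<in> parcs G}" for x
  \<comment> \<open>\<open>W i\<close> and \<open>J i\<close> will be the vertex sets of the families \<open>\<H>\<^sub>i\<close> and \<open>\<H>\<^bsub>i,i+1\<^esub>\<close>.\<close>
  define W where "W i = {x \<in> X. (x, u 0) \<notin> parcs G \<and> (x, u d) \<notin> parcs G \<and> A x = {i}}" for i
  define J where "J i = {x \<in> X. (x, u 0) \<notin> parcs G \<and> (x, u d) \<notin> parcs G \<and> A x = {i, Suc i}}" for i
  define Hv where "Hv = {x \<in> X. (x, u 0) \<in> parcs G}"
  define Hw where "Hw = {x \<in> X. (x, u d) \<in> parcs G}"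
  have sym: "(x, y) \<in> parcs G \<longleftrightarrow> (y, x) \<in> parcs G" for x y
    using arcs_symmetric by blast
  have irrefl: "(x, x) \<notin> parcs G" for x
    using no_loops' by blast
  have ueq: "u i = u j \<longleftrightarrow> i = j" if "i \<le> d" "j \<le> d" for i j
    using inj_on_eq_iff[OF inj] that by simp
  have uP: "u i \<in> P" if "i \<le> d" for i using that by (auto simp: P_def)
  have X: "x \<in> pverts G" "x \<noteq> u i" if "x \<in> X" "i \<le> d" for x i
    using that uP unfolding X_def by blast+
  have XV: "X \<subseteq> pverts G" and PV: "P \<subseteq> pverts G" and XP: "X \<inter> P = {}"
    using uV by (auto simp: X_def P_def)
  have finX: "finite X" using XV pair_finite_verts finite_subset by blast
  have "u ` {1..<d} \<subseteq> P" by (auto simp: P_def)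
  then have XF: "X \<subseteq> free_verts G" using nonfree unfolding X_def by blast
  have endF: "u 0 \<in> free_verts G" "u d \<in> free_verts G"
  proof -
    have "u 0 \<notin> u ` {1..<d}" "u d \<notin> u ` {1..<d}" using ueq d by (auto simp: image_iff)
    then show "u 0 \<in> free_verts G" "u d \<in> free_verts G"
      using nonfree PV uP[of 0] uP[of d] by blast+
  qed
  have clique: "(y, z) \<in> parcs G"
    if "x \<in> free_verts G" "(x, y) \<in> parcs G" "(x, z) \<in> parcs G" "y \<noteq> z" for x y z
    using that unfolding free_verts_iff by blast
  \<comment> \<open>\<open>x\<close> is a free twin of the end \<open>u 0\<close>, whose only path
    neighbour is \<open>u 1\<close>; the same holds below for \<open>u d\<close>.\<close>
  have A_Hv: "A x = {1}" if "x \<in> Hv" for x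
  proof -
    have "(x, u i) \<in> parcs G \<longleftrightarrow> (u 0, u i) \<in> parcs G" if "1 \<le> i" "i < d" for i
      using free_twins[of x "u 0" "u i"] \<open>x \<in> Hv\<close> XF endF X(2)[of x i] ueq[of i 0] that
      unfolding Hv_def by auto
    then show ?thesis using adj[of 0] d unfolding A_def by auto
  qed
  have A_Hw: "A x = {d - 1}" if "x \<in> Hw" for x
  proof -
    have "(x, u i) \<in> parcs G \<longleftrightarrow> (u d, u i) \<in> parcs G" if "1 \<le> i" "i < d" for i
      using free_twins[of x "u d" "u i"] \<open>x \<in> Hw\<close> XF endF X(2)[of x i] ueq[of i d] that
      unfolding Hw_def by auto
    then show ?thesis using adj[of d] d unfolding A_def by auto
  qed
  \<comment> \<open>A common vertex, being free, would make the two ends of the path adjacent, which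
    \<open>d \<ge> 2\<close> forbids.\<close>
  have HvHw: "Hv \<inter> Hw = {}"
  proof -
    have "x \<notin> Hw" if "x \<in> Hv" for x
    proof
      assume "x \<in> Hw"
      then have "(u 0, u d) \<in> parcs G"
        using that clique[of x "u 0" "u d"] XF ueq[of 0 d] d unfolding Hv_def Hw_def by auto
      then show False using adj[of 0 d] d by auto
    qed
    then show ?thesis by blast
  qed
  \<comment> \<open>Nonempty by \<open>free_adjacent_nonfree\<close>. Every other index is adjacent
    on the path to the least one \<open>m\<close>, hence equals \<open>Suc m\<close>.\<close>
  have A_cases: "\<exists>i. A x = {i} \<or> A x = {i, Suc i}" if x: "x \<in> X" for x
  proof -
    have "u 1 \<in> pverts G - free_verts G" unfolding nonfree using d by auto
    then obtain y where "y \<in> u ` {1..<d}" "(x, y) \<in> parcs G"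
      using free_adjacent_nonfree[OF conn, of x "u 1"] XF x unfolding nonfree by blast
    then have ne: "A x \<noteq> {}" by (auto simp: A_def)
    define m where "m = Min (A x)"
    have fin: "finite (A x)" by (rule finite_subset[of _ "{..<d}"]) (auto simp: A_def)
    have m: "m \<in> A x" "\<And>j. j \<in> A x \<Longrightarrow> m \<le> j"
      unfolding m_def using fin ne by (auto intro: Min_in)
    have "j = m \<or> j = Suc m" if "j \<in> A x" for j
    proof (cases "j = m")
      case False
      then have "(u m, u j) \<in> parcs G"
        using clique[of x "u m" "u j"] XF x m that ueq[of m j] unfolding A_def by auto
      then show ?thesis using adj[of m j] m(1) m(2)[OF that] that unfolding A_def by auto
    qed simp
    then have "A x \<subseteq> {m, Suc m}" by blast
    then have "A x = {m} \<or> A x = {m, Suc m}" using m(1) by blast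
    then show ?thesis by blast
  qed
  have class_eq: "A x = A y \<and> ((x, u 0) \<in> parcs G \<longleftrightarrow> (y, u 0) \<in> parcs G) \<and>
      ((x, u d) \<in> parcs G \<longleftrightarrow> (y, u d) \<in> parcs G)"
    if "x \<in> X" "y \<in> X" "(x, y) \<in> parcs G" for x y
  proof -
    have "(x, u i) \<in> parcs G \<longleftrightarrow> (y, u i) \<in> parcs G" if "i \<le> d" for i
      using free_twins[of x y "u i"] \<open>x \<in> X\<close> \<open>y \<in> X\<close> \<open>(x, y) \<in> parcs G\<close> XF
        X(2)[of x i] X(2)[of y i] that by auto
    then show ?thesis by (auto simp: A_def)
  qed
  have Xtrans: "(x, z) \<in> parcs G"
    if "x \<in> X" "y \<in> X" "z \<in> X" "(x, y) \<in> parcs G" "(y, z) \<in> parcs G" "x \<noteq> z" for x y z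
    using clique[of y x z] that XF sym by blast
  have ex: "\<exists>L. pairwise_disjoint_verts L \<and> (\<forall>C\<in>set L. \<exists>l\<ge>1. complete_digraph l (with_proj C)) \<and>
    verts_of L = Y \<and> arcs_of L = parcs G \<inter> Y \<times> Y" if "Y \<subseteq> X" for Y
  proof (rule clique_partition)
    show "finite Y" using that finX finite_subset by blast
    show "\<And>x y. (x, y) \<in> parcs G \<Longrightarrow> (y, x) \<in> parcs G" using sym by blast
    show "\<And>x. (x, x) \<notin> parcs G" by (rule irrefl)
    show "\<And>x y z. x \<in> Y \<Longrightarrow> y \<in> Y \<Longrightarrow> z \<in> Y \<Longrightarrow> (x, y) \<in> parcs G \<Longrightarrow> (y, z) \<in> parcs G \<Longrightarrow>
      x \<noteq> z \<Longrightarrow> (x, z) \<in> parcs G" using that Xtrans by blast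
  qed
  obtain part where part:
    "\<And>Y. Y \<subseteq> X \<Longrightarrow> pairwise_disjoint_verts (part Y)"
    "\<And>Y C. Y \<subseteq> X \<Longrightarrow> C \<in> set (part Y) \<Longrightarrow> \<exists>l\<ge>1. complete_digraph l (with_proj C)"
    "\<And>Y. Y \<subseteq> X \<Longrightarrow> verts_of (part Y) = Y"
    "\<And>Y. Y \<subseteq> X \<Longrightarrow> arcs_of (part Y) = parcs G \<inter> Y \<times> Y"
    using ex by metis
  define Hs where "Hs i = part (W i)" for i
  define Js where "Js i = part (J i)" for i
  have "W i \<subseteq> X" "J i \<subseteq> X" for i by (auto simp: W_def J_def)
  note Hs = part[OF this(1), folded Hs_def] and Js = part[OF this(2), folded Js_def]
  define Cs where "Cs = complete_on Hv # complete_on Hw #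
    concat (map Hs [1..<d]) @ concat (map Js [1..<d - 1])"
  have WJ: "W i \<inter> W j = {}" "J i \<inter> J j = {}" if "i < j" for i j
    using that by (auto simp: W_def J_def doubleton_eq_iff)
  have WJ': "W i \<inter> J j = {}" "x \<in> Hv \<or> x \<in> Hw \<Longrightarrow> x \<notin> W i" "x \<in> Hv \<or> x \<in> Hw \<Longrightarrow> x \<notin> J j" for i j x
    by (auto simp: W_def J_def Hv_def Hw_def)
  have vCs: "verts_of Cs = Hv \<union> Hw \<union> (\<Union>i\<in>{1..<d}. W i) \<union> (\<Union>i\<in>{1..<d-1}. J i)"
    by (simp add: Cs_def Hs Js Un_assoc)
  have disj: "pairwise_disjoint_verts Cs"
    unfolding Cs_def using HvHw WJ' WJ
    by (auto simp: Hs Js pairwise_disjoint_verts_concat_map)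
  have Wi: "1 \<le> i \<and> i < d" if "x \<in> W i" for x i using that by (auto simp: W_def A_def)
  have Ji: "1 \<le> i \<and> i < d - 1" if "x \<in> J i" for x i
  proof -
    have "i \<in> A x" "Suc i \<in> A x" using that by (auto simp: J_def)
    then show ?thesis by (auto simp: A_def)
  qed
  have verts: "verts_of Cs = X"
  proof
    show "verts_of Cs \<subseteq> X" unfolding vCs by (auto simp: Hv_def Hw_def W_def J_def)
    show "X \<subseteq> verts_of Cs"
    proof
      fix x assume x: "x \<in> X"
      obtain i where "A x = {i} \<or> A x = {i, Suc i}" using A_cases[OF x] by blast
      then have "x \<in> Hv \<or> x \<in> Hw \<or> x \<in> W i \<or> x \<in> J i"
        using x by (auto simp: Hv_def Hw_def W_def J_def)
      then show "x \<in> verts_of Cs" unfolding vCs using Wi[of x i] Ji[of x i] by auto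
    qed
  qed
  \<comment> \<open>One formula for all inner path vertices, also for \<open>d = 2\<close>, where
    \<open>i = 1\<close> and \<open>i = d - 1\<close> coincide. The separate clauses of
    \<open>built_\<G>\<close> are read off from it using \<open>J 0 = {}\<close> and
    \<open>J (d - 1) = {}\<close>.\<close>
  have nbr: "x \<in> nbrs G (u i) \<longleftrightarrow> x = u (i - 1) \<or> x = u (i + 1) \<or>
      i = 1 \<and> x \<in> Hv \<or> i = d - 1 \<and> x \<in> Hw \<or> x \<in> W i \<or> x \<in> J (i - 1) \<or> x \<in> J i"
    if i: "1 \<le> i" "i < d" for i x
  proof (cases "x \<in> P")
    case True
    then obtain j where j: "x = u j" "j \<le> d" by (auto simp: P_def)
    have "x \<notin> X" using True XP by blast
    then have "x \<notin> Hv" "x \<notin> Hw" "x \<notin> W i" "x \<notin> J (i - 1)" "x \<notin> J i"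
      by (auto simp: Hv_def Hw_def W_def J_def)
    moreover have "x \<in> nbrs G (u i) \<longleftrightarrow> j = i - 1 \<or> j = i + 1"
      using adj[of i j] i j by (auto simp: nbrs_def)
    ultimately show ?thesis using ueq[of j "i - 1"] ueq[of j "i + 1"] i j by auto
  next
    case False
    have *: "x \<noteq> u (i - 1)" "x \<noteq> u (i + 1)"
      using False uP[of "i - 1"] uP[of "i + 1"] i by auto
    show ?thesis
    proof (cases "x \<in> X")
      case True
      have "x \<in> nbrs G (u i) \<longleftrightarrow> i \<in> A x" using sym i by (auto simp: nbrs_def A_def)
      also have "\<dots> \<longleftrightarrow> i = 1 \<and> x \<in> Hv \<or> i = d - 1 \<and> x \<in> Hw \<or> x \<in> W i \<or> x \<in> J (i - 1) \<or> x \<in> J i"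
      proof
        assume iA: "i \<in> A x"
        obtain m where "A x = {m} \<or> A x = {m, Suc m}" using A_cases[OF True] by blast
        then have m: "A x = {m} \<and> i = m \<or> A x = {m, Suc m} \<and> (i = m \<or> i = Suc m)"
          using iA by auto
        show "i = 1 \<and> x \<in> Hv \<or> i = d - 1 \<and> x \<in> Hw \<or> x \<in> W i \<or> x \<in> J (i - 1) \<or> x \<in> J i"
        proof (cases "x \<in> Hv \<or> x \<in> Hw")
          case True
          then show ?thesis using A_Hv[of x] A_Hw[of x] iA by blast
        next
          case False
          then have n: "(x, u 0) \<notin> parcs G" "(x, u d) \<notin> parcs G"
            using \<open>x \<in> X\<close> by (simp_all add: Hv_def Hw_def)
          from m have "x \<in> W i \<or> x \<in> J (i - 1) \<or> x \<in> J i"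
            by (elim disjE conjE) (use n \<open>x \<in> X\<close> in \<open>simp_all add: W_def J_def\<close>)
          then show ?thesis by blast
        qed
      next
        assume "i = 1 \<and> x \<in> Hv \<or> i = d - 1 \<and> x \<in> Hw \<or> x \<in> W i \<or> x \<in> J (i - 1) \<or> x \<in> J i"
        then show "i \<in> A x"
          using A_Hv[of x] A_Hw[of x] i by (auto simp: W_def J_def)
      qed
      finally show ?thesis using * by blast
    next
      case xX: False
      then have "x \<notin> pverts G" using False by (simp add: X_def)
      then have "x \<notin> nbrs G (u i)" using in_arcsD2 by (auto simp: nbrs_def)
      then show ?thesis using * xX by (auto simp: Hv_def Hw_def W_def J_def)
    qed
  qed
  have nv: "nbrs G (u 0) = {u 1} \<union> Hv"
  proof (intro set_eqI)
    fix x
    show "x \<in> nbrs G (u 0) \<longleftrightarrow> x \<in> {u 1} \<union> Hv"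
    proof (cases "x \<in> P")
      case True
      then obtain j where j: "x = u j" "j \<le> d" by (auto simp: P_def)
      then show ?thesis using adj[of 0 j] ueq[of j 1] X(2)[of x j] d
        by (auto simp: nbrs_def Hv_def)
    next
      case False
      then have "x \<noteq> u 1" using uP[of 1] d by auto
      then show ?thesis using False sym in_arcsD2 by (auto simp: nbrs_def Hv_def X_def)
    qed
  qed
  have nw: "nbrs G (u d) = {u (d - 1)} \<union> Hw"
  proof (intro set_eqI)
    fix x
    show "x \<in> nbrs G (u d) \<longleftrightarrow> x \<in> {u (d - 1)} \<union> Hw"
    proof (cases "x \<in> P")
      case True
      then obtain j where j: "x = u j" "j \<le> d" by (auto simp: P_def)
      then show ?thesis using adj[of d j] ueq[of j "d - 1"] X(2)[of x j] d
        by (auto simp: nbrs_def Hw_def)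
    next
      case False
      then have "x \<noteq> u (d - 1)" using uP[of "d - 1"] d by auto
      then show ?thesis using False sym in_arcsD2 by (auto simp: nbrs_def Hw_def X_def)
    qed
  qed
  have J0: "J 0 = {}" "J (d - 1) = {}" using Ji[of _ 0] Ji[of _ "d - 1"] by auto
  have arcs: "arcs_of Cs = parcs G \<inter> X \<times> X"
  proof -
    \<comment> \<open>The neighbours of a free vertex form a clique. Hence \<open>Hv\<close> and
      \<open>Hw\<close> can each be taken as one complete graph, while \<open>W i\<close> and
      \<open>J i\<close> may split into several.\<close>
    have cl: "parcs (complete_on {x \<in> X. (x, c) \<in> parcs G}) =
        parcs G \<inter> {x \<in> X. (x, c) \<in> parcs G} \<times> {x \<in> X. (x, c) \<in> parcs G}"
      if "c \<in> free_verts G" for c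
      using clique[OF that] sym irrefl by auto
    have "arcs_of Cs = parcs G \<inter> (Hv \<times> Hv \<union> Hw \<times> Hw \<union> (\<Union>i\<in>{1..<d}. W i \<times> W i)
        \<union> (\<Union>i\<in>{1..<d-1}. J i \<times> J i))"
      unfolding Cs_def arcs_of_simps
        cl[OF endF(1), folded Hv_def] cl[OF endF(2), folded Hw_def]
      by (simp only: set_map set_upt image_image Hs(4) Js(4)) blast
    \<comment> \<open>By \<open>class_eq\<close>, no arc inside \<open>X\<close> joins two different
      classes.\<close>
    also have "\<dots> = parcs G \<inter> X \<times> X"
    proof (intro set_eqI iffI)
      fix p assume p: "p \<in> parcs G \<inter> X \<times> X"
      obtain x y where xy: "p = (x, y)" "x \<in> X" "y \<in> X" "(x, y) \<in> parcs G" using p by auto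
      have "x \<in> Hv \<longleftrightarrow> y \<in> Hv" "x \<in> Hw \<longleftrightarrow> y \<in> Hw" "\<And>i. x \<in> W i \<longleftrightarrow> y \<in> W i" "\<And>i. x \<in> J i \<longleftrightarrow> y \<in> J i"
        using class_eq[OF xy(2-4)] xy(2,3) by (simp_all add: Hv_def Hw_def W_def J_def)
      moreover have "x \<in> Hv \<union> Hw \<union> (\<Union>i\<in>{1..<d}. W i) \<union> (\<Union>i\<in>{1..<d-1}. J i)"
        using verts xy(2) unfolding vCs by simp
      ultimately have "x \<in> Hv \<and> y \<in> Hv \<or> x \<in> Hw \<and> y \<in> Hw \<or>
          (\<exists>i\<in>{1..<d}. x \<in> W i \<and> y \<in> W i) \<or> (\<exists>i\<in>{1..<d-1}. x \<in> J i \<and> y \<in> J i)"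
        by blast
      then show "p \<in> parcs G \<inter> (Hv \<times> Hv \<union> Hw \<times> Hw \<union> (\<Union>i\<in>{1..<d}. W i \<times> W i)
        \<union> (\<Union>i\<in>{1..<d-1}. J i \<times> J i))" using xy by blast
    qed (auto simp: Hv_def Hw_def W_def J_def)
    finally show ?thesis .
  qed
  have complete: "\<exists>m. complete_digraph m (with_proj C)" if "C \<in> set Cs" for C
  proof -
    have "finite Hv" "finite Hw" using finX by (auto simp: Hv_def Hw_def)
    then show ?thesis
      using that Hs(2) Js(2) complete_digraph_complete_on unfolding Cs_def by fastforce
  qed
  have outside: "with_proj G \<restriction> (pverts G - P) = with_proj (graph_union Cs)"
    unfolding graph_union_eq verts arcs
    by (auto simp: induce_subgraph_def with_proj_def X_def)
  have PCs: "P \<inter> verts_of Cs = {}" "pverts G = P \<union> verts_of Cs"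
    unfolding verts using XP PV by (auto simp: X_def)
  have n1: "nbrs G (u 1) = {u 0, u 2} \<union> Hv \<union> W 1 \<union> J 1"
    and nd: "nbrs G (u (d - 1)) = {u d, u (d - 2)} \<union> Hw \<union> W (d - 1) \<union> J (d - 2)" if "3 \<le> d"
    using nbr[of 1] nbr[of "d - 1"] that J0 by (auto simp: numeral_2_eq_2)
  have ni: "nbrs G (u i) = {u (i - 1), u (i + 1)} \<union> W i \<union> J (i - 1) \<union> J i"
    if "i \<in> {2..d - 2}" for i
    using nbr[of i] that by auto
  have n2: "nbrs G (u 1) = {u 0, u 2} \<union> Hv \<union> Hw \<union> W 1" if "d = 2"
    using nbr[of 1] that J0 by (auto simp: numeral_2_eq_2)
  show ?thesis
    unfolding built_\<G>_def Let_def
    apply (rule conjI[OF d conjI[OF pair_graph]])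
    apply (rule exI[of _ u], rule exI[of _ "complete_on Hv"], rule exI[of _ "complete_on Hw"],
        rule exI[of _ Hs], rule exI[of _ Js])
    unfolding Cs_def[symmetric] P_def[symmetric] Hs(3) Js(3) complete_on_simps(1)
    using inj complete disj PCs nv nw n1 nd ni n2 outside
    by (intro conjI ballI impI) (assumption | blast)+
qed

end

text \<open>The nonfree vertices become \<open>K\<close> and the free ones are split into cliques.
  The nonfree vertices are pairwise adjacent because they are all neighbours of the free vertex
  \<open>v\<close>.\<close>

lemma (in pair_graph) built_\<F>I:
  assumes q: "2 \<le> card (pverts G - free_verts G)"
    and join: "\<And>x s. x \<in> free_verts G \<Longrightarrow> s \<in> pverts G - free_verts G \<Longrightarrow> (x, s) \<in> parcs G"
    and vw: "v \<in> free_verts G" "w \<in> free_verts G" "v \<noteq> w" "(v, w) \<notin> parcs G"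
  shows "built_\<F> (card (pverts G - free_verts G)) G"
proof -
  define S where "S = pverts G - free_verts G"
  define F where "F = free_verts G"
  have sym: "(x, y) \<in> parcs G \<longleftrightarrow> (y, x) \<in> parcs G" and irrefl: "(x, x) \<notin> parcs G" for x y
    using arcs_symmetric no_loops' by blast+
  have clique: "(y, z) \<in> parcs G"
    if "x \<in> free_verts G" "(x, y) \<in> parcs G" "(x, z) \<in> parcs G" "y \<noteq> z" for x y z
    using that unfolding free_verts_iff by blast
  have "finite F" using pair_finite_verts free_verts_subset finite_subset unfolding F_def by blast
  then have "\<exists>Fs. pairwise_disjoint_verts Fs \<and>
      (\<forall>C\<in>set Fs. \<exists>l\<ge>1. complete_digraph l (with_proj C)) \<and>
      verts_of Fs = F \<and> arcs_of Fs = parcs G \<inter> F \<times> F"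
    by (rule clique_partition) (use sym irrefl clique in \<open>unfold F_def, blast+\<close>)
  then obtain Fs where Fs: "pairwise_disjoint_verts Fs"
      "\<forall>C\<in>set Fs. \<exists>l\<ge>1. complete_digraph l (with_proj C)"
      "verts_of Fs = F" "arcs_of Fs = parcs G \<inter> F \<times> F" by blast
  \<comment> \<open>A single clique could not contain both of the nonadjacent \<open>v\<close> and
    \<open>w\<close>, and with none there would be no free vertex.\<close>
  have "2 \<le> length Fs"
  proof (rule ccontr)
    assume "\<not> 2 \<le> length Fs"
    then have "length Fs = 0 \<or> length Fs = 1" by linarith
    then consider "Fs = []" | C where "Fs = [C]" by (auto simp: length_Suc_conv)
    then show False
    proof cases
      case 1
      then show False using Fs(3) vw by (simp add: F_def)
    next
      case 2
      then have "parcs C = {(u, v). (u, v) \<in> F \<times> F \<and> u \<noteq> v}"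
        using Fs(2,3) by (auto simp: complete_digraph_pair_def)
      then show False using Fs(4) vw 2 by (auto simp: F_def)
    qed
  qed
  moreover have "finite S" using pair_finite_verts by (simp add: S_def)
  then have "complete_digraph (card S) (with_proj (complete_on S))"
    by (rule complete_digraph_complete_on)
  moreover have "pairwise_disjoint_verts (complete_on S # Fs)"
    using Fs by (auto simp: S_def F_def)
  moreover have "G = graph_join (complete_on S) (graph_union Fs)"
  proof -
    have V: "pverts G = S \<union> F" using free_verts_subset by (auto simp: S_def F_def)
    have SS: "(x, y) \<in> parcs G" if "x \<in> S" "y \<in> S" "x \<noteq> y" for x y
      using clique[OF vw(1) join[OF vw(1)] join[OF vw(1)]] that by (simp add: S_def)
    have "parcs G = {(x, y). x \<in> S \<and> y \<in> S \<and> x \<noteq> y} \<union> parcs G \<inter> F \<times> F \<union> S \<times> F \<union> F \<times> S"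
    proof (intro set_eqI iffI)
      fix p assume p: "p \<in> parcs G"
      obtain x y where xy: "p = (x, y)" by (cases p)
      then have "x \<in> S \<union> F" "y \<in> S \<union> F" "x \<noteq> y"
        using p in_arcsD1 in_arcsD2 irrefl unfolding V[symmetric] by blast+
      then show "p \<in> {(x, y). x \<in> S \<and> y \<in> S \<and> x \<noteq> y} \<union> parcs G \<inter> F \<times> F \<union> S \<times> F \<union> F \<times> S"
        using p xy by blast
    next
      fix p assume p: "p \<in> {(x, y). x \<in> S \<and> y \<in> S \<and> x \<noteq> y} \<union> parcs G \<inter> F \<times> F \<union> S \<times> F \<union> F \<times> S"
      have "(x, s) \<in> parcs G" "(s, x) \<in> parcs G" if "x \<in> F" "s \<in> S" for x s
        using join[of x s] that sym[of x s] by (simp_all add: S_def F_def)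
      then show "p \<in> parcs G" using p SS by blast
    qed
    then show ?thesis
      unfolding graph_join_def graph_union_eq Fs(3,4)
      by (intro pair_pre_digraph.equality) (simp_all add: V)
  qed
  ultimately show ?thesis
    unfolding built_\<F>_def S_def[symmetric] using q[folded S_def] Fs(2) by blast
qed

section \<open>Nonfree vertices and separation in the constructed graphs\<close>

lemma pairwise_disjoint_verts_unique:
  assumes "pairwise_disjoint_verts Cs" "C \<in> set Cs" "D \<in> set Cs" "x \<in> pverts C" "x \<in> pverts D"
  shows "C = D"
  using assms by (induction Cs) (auto simp: verts_of_def)

lemma pairwise_disjoint_verts_concat_mapD:
  assumes "pairwise_disjoint_verts (concat (map f [a..<b]))"
    and "i \<in> {a..<b}" "j \<in> {a..<b}" "i \<noteq> j"
  shows "verts_of (f i) \<inter> verts_of (f j) = {}"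
  using assms
proof (induction b)
  case (Suc b)
  then have "a \<le> b" by simp
  with Suc.prems(1) have *: "pairwise_disjoint_verts (concat (map f [a..<b]))"
    "(\<Union>i\<in>{a..<b}. verts_of (f i)) \<inter> verts_of (f b) = {}" by auto
  consider "i = b" "j \<in> {a..<b}" | "j = b" "i \<in> {a..<b}" | "i \<in> {a..<b}" "j \<in> {a..<b}"
    using Suc.prems by fastforce
  then show ?case
  proof cases
    case 3
    then show ?thesis using Suc.IH[OF *(1)] Suc.prems(4) by blast
  qed (use *(2) in blast)+
qed simp

text \<open>A vertex of \<open>K\<close> sees two nonadjacent vertices from different cliques, so it
  is nonfree, and it is adjacent to all other vertices. A vertex of a clique \<open>F\<close> sees
  only \<open>K\<close> and \<open>F\<close>, which are complete to each other, so it is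
  free.\<close>

lemma built_\<F>D:
  assumes "built_\<F> q H"
  shows "card (pverts H - free_verts H) = q"
    and "\<exists>c\<in>pverts H. \<forall>x\<in>pverts H. x \<noteq> c \<longrightarrow> (c, x) \<in> parcs H"
    and "\<exists>v\<in>pverts H. \<exists>w\<in>pverts H. v \<noteq> w \<and> (v, w) \<notin> parcs H"
proof -
  obtain K Fs where q: "2 \<le> q" and K: "complete_digraph q (with_proj K)" and len: "2 \<le> length Fs"
    and Fs: "\<forall>F\<in>set Fs. \<exists>l\<ge>1. complete_digraph l (with_proj F)"
    and disj: "pairwise_disjoint_verts (K # Fs)" and H: "H = graph_join K (graph_union Fs)"
    using assms unfolding built_\<F>_def by blast
  have V: "pverts H = pverts K \<union> verts_of Fs"
    and E: "parcs H = parcs K \<union> arcs_of Fs \<union> pverts K \<times> verts_of Fs \<union> verts_of Fs \<times> pverts K"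
    unfolding H graph_join_def graph_union_eq by simp_all
  have EK: "parcs K = {(x, y). x \<in> pverts K \<and> y \<in> pverts K \<and> x \<noteq> y}"
    using K by (auto simp: complete_digraph_pair_def)
  have EF: "parcs F = {(x, y). x \<in> pverts F \<and> y \<in> pverts F \<and> x \<noteq> y}" "pverts F \<noteq> {}"
    if "F \<in> set Fs" for F
    using Fs that by (auto simp: complete_digraph_pair_def)
  have KF: "pverts K \<inter> verts_of Fs = {}" and pd: "pairwise_disjoint_verts Fs" using disj by auto
  have arcF: "(x, y) \<in> arcs_of Fs \<longleftrightarrow> y \<in> pverts F \<and> x \<noteq> y" if "F \<in> set Fs" "x \<in> pverts F" for F x y
    using that EF(1) pairwise_disjoint_verts_unique[OF pd] unfolding arcs_of_def by fastforce
  \<comment> \<open>Vertices of the first two cliques provide the nonadjacent pair.\<close>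
  obtain A B Rs where AB: "Fs = A # B # Rs"
    using len by (metis Suc_le_length_iff numeral_2_eq_2)
  obtain a b where ab: "a \<in> pverts A" "b \<in> pverts B" using EF(2) AB by fastforce
  have "b \<notin> pverts A" using pd ab unfolding AB by auto
  then have nab: "(a, b) \<notin> arcs_of Fs" "a \<noteq> b" using arcF[of A a b] ab AB by auto
  have abV: "a \<in> verts_of Fs" "b \<in> verts_of Fs" using ab AB by auto
  have nE: "(a, b) \<notin> parcs H" using nab abV KF unfolding E EK by blast
  then show "\<exists>v\<in>pverts H. \<exists>w\<in>pverts H. v \<noteq> w \<and> (v, w) \<notin> parcs H"
    using nab abV V by blast
  have cK: "card (pverts K) = q" using K by (simp add: complete_digraph_pair_def)
  then have "pverts K \<noteq> {}" using q by auto
  then obtain c where c: "c \<in> pverts K" by blast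
  then show "\<exists>c\<in>pverts H. \<forall>x\<in>pverts H. x \<noteq> c \<longrightarrow> (c, x) \<in> parcs H"
    unfolding V E EK by blast
  have "x \<notin> free_verts H" if "x \<in> pverts K" for x
    using nE abV nab(2) that unfolding free_verts_def nbrs_def E by blast
  moreover have "x \<in> free_verts H" if x: "x \<in> verts_of Fs" for x
  proof -
    obtain F where F: "F \<in> set Fs" "x \<in> pverts F" using x by (auto simp: verts_of_def)
    have nb: "(x, y) \<in> parcs H \<longleftrightarrow> y \<in> pverts K \<or> y \<in> pverts F \<and> x \<noteq> y" for y
      using x arcF[OF F] KF unfolding E EK by blast
    have "(y, z) \<in> parcs H" if "y \<in> pverts K \<union> pverts F" "z \<in> pverts K \<union> pverts F" "y \<noteq> z" for y z
    proof -
      have "pverts F \<subseteq> verts_of Fs" using F by (auto simp: verts_of_def)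
      then show ?thesis using that arcF[OF F(1), of y z] unfolding E EK by blast
    qed
    then show ?thesis using x nb unfolding free_verts_def nbrs_def V by blast
  qed
  ultimately have "pverts H - free_verts H = pverts K" unfolding V using KF by blast
  then show "card (pverts H - free_verts H) = q" using cK by simp
qed

text \<open>An isomorphism carries its own arc map. Since head and tail of both graphs are the
  projections, that map must send \<open>(x, y)\<close> to
  \<open>(\<phi> x, \<phi> y)\<close>.\<close>

lemma digraph_iso_bij:
  assumes "digraph_iso (with_proj H) (with_proj G)"
  obtains \<phi> where "bij_betw \<phi> (pverts H) (pverts G)"
    "\<And>x y. x \<in> pverts H \<Longrightarrow> y \<in> pverts H \<Longrightarrow> (\<phi> x, \<phi> y) \<in> parcs G \<longleftrightarrow> (x, y) \<in> parcs H"
proof -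
  obtain f where f: "pre_digraph.digraph_isomorphism (with_proj H) f" "with_proj G = app_iso f (with_proj H)"
    using assms by (auto simp: digraph_iso_def)
  define \<phi> where "\<phi> = iso_verts f"
  have "verts (with_proj G) = \<phi> ` pverts H" "arcs (with_proj G) = iso_arcs f ` parcs H"
    "tail (with_proj G) = iso_tail f" "head (with_proj G) = iso_head f"
    unfolding f(2) by (simp_all add: \<phi>_def)
  then have G: "pverts G = \<phi> ` pverts H" "parcs G = iso_arcs f ` parcs H"
    "iso_tail f = fst" "iso_head f = snd" by simp_all
  have wf: "wf_digraph (with_proj H)" and inj: "inj_on \<phi> (pverts H)"
    and ends: "\<And>a. a \<in> parcs H \<Longrightarrow> \<phi> (fst a) = fst (iso_arcs f a) \<and> \<phi> (snd a) = snd (iso_arcs f a)"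
    using f(1) G(3,4) by (auto simp: pre_digraph.digraph_isomorphism_def \<phi>_def)
  have HV: "x \<in> pverts H" "y \<in> pverts H" if "(x, y) \<in> parcs H" for x y
    using wf that wf_digraph.head_in_verts[OF wf] wf_digraph.tail_in_verts[OF wf] by fastforce+
  have "parcs G = (\<lambda>(x, y). (\<phi> x, \<phi> y)) ` parcs H"
    unfolding G(2) by (intro image_cong refl) (use ends in \<open>auto simp: prod_eq_iff\<close>)
  note EG = this
  have "(\<phi> x, \<phi> y) \<in> parcs G \<longleftrightarrow> (x, y) \<in> parcs H" if xy: "x \<in> pverts H" "y \<in> pverts H" for x y
  proof
    assume "(\<phi> x, \<phi> y) \<in> parcs G"
    then obtain a b where ab: "(a, b) \<in> parcs H" "\<phi> x = \<phi> a" "\<phi> y = \<phi> b" unfolding EG by auto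
    then have "x = a" "y = b" using inj_on_eq_iff[OF inj] xy HV[OF ab(1)] by simp_all
    then show "(x, y) \<in> parcs H" using ab by simp
  next
    assume "(x, y) \<in> parcs H"
    then show "(\<phi> x, \<phi> y) \<in> parcs G" unfolding EG by (rule rev_image_eqI) simp
  qed
  moreover have "bij_betw \<phi> (pverts H) (pverts G)" using inj G(1) by (simp add: bij_betw_def)
  ultimately show ?thesis by (intro that)
qed


text \<open>The two path neighbours of an inner vertex are distinct and nonadjacent.\<close>

lemma (in pair_graph) induced_path_inner_nonfree:
  assumes inj: "inj_on u {0..d}"
    and adj: "\<And>i j. i \<le> d \<Longrightarrow> j \<le> d \<Longrightarrow> (u i, u j) \<in> parcs G \<longleftrightarrow> j = Suc i \<or> i = Suc j"
    and i: "i \<in> {1..<d}"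
  shows "u i \<notin> free_verts G"
proof -
  obtain k where k: "i = Suc k" "Suc (Suc k) \<le> d" using i by (cases i) auto
  then have "(u i, u k) \<in> parcs G" "(u i, u (Suc (Suc k))) \<in> parcs G"
    "(u k, u (Suc (Suc k))) \<notin> parcs G"
    by (simp_all add: adj)
  moreover have "u k \<noteq> u (Suc (Suc k))"
    using inj_on_eq_iff[OF inj, of k "Suc (Suc k)"] k by simp
  ultimately show ?thesis unfolding free_verts_iff by blast
qed

text \<open>Off-path vertices and both ends are free, inner path vertices are not. The second
  conclusion encodes that \<open>u 1\<close> is a cut vertex: it separates \<open>u 0\<close> and
  \<open>Hv\<close> from \<open>u 2\<close>.\<close>

lemma built_\<G>D:
  assumes "built_\<G> d H"
  shows "card (pverts H - free_verts H) = d - 1"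
    and "\<exists>c\<in>pverts H. \<exists>A. A \<subset> pverts H - {c} \<and> A \<noteq> {} \<and> (\<forall>x\<in>A. nbrs H x \<subseteq> insert c A)"
proof -
  obtain u Hv Hw Hs Js where
    d: "2 \<le> d" and gr: "pair_graph H" and inj: "inj_on u {0..d}" and
    complete: "\<forall>C\<in>set (Hv # Hw # concat (map Hs [1..<d]) @ concat (map Js [1..<d - 1])).
      \<exists>m. complete_digraph m (with_proj C)" and
    pd: "pairwise_disjoint_verts (Hv # Hw # concat (map Hs [1..<d]) @ concat (map Js [1..<d - 1]))" and
    PCs: "u ` {0..d} \<inter>
      verts_of (Hv # Hw # concat (map Hs [1..<d]) @ concat (map Js [1..<d - 1])) = {}" and
    V: "pverts H = u ` {0..d} \<union>
      verts_of (Hv # Hw # concat (map Hs [1..<d]) @ concat (map Js [1..<d - 1]))" and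
    nv: "nbrs H (u 0) = {u 1} \<union> pverts Hv" and
    nw: "nbrs H (u d) = {u (d - 1)} \<union> pverts Hw" and
    n3: "3 \<le> d \<Longrightarrow>
      nbrs H (u 1) = {u 0, u 2} \<union> pverts Hv \<union> verts_of (Hs 1) \<union> verts_of (Js 1) \<and>
      nbrs H (u (d - 1)) =
        {u d, u (d - 2)} \<union> pverts Hw \<union> verts_of (Hs (d - 1)) \<union> verts_of (Js (d - 2)) \<and>
      (\<forall>i\<in>{2..d - 2}. nbrs H (u i) =
        {u (i - 1), u (i + 1)} \<union> verts_of (Hs i) \<union> verts_of (Js (i - 1)) \<union> verts_of (Js i))" and
    n2: "d = 2 \<Longrightarrow> nbrs H (u 1) = {u 0, u 2} \<union> pverts Hv \<union> pverts Hw \<union> verts_of (Hs 1)" and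
    outside: "with_proj H \<restriction> (pverts H - u ` {0..d}) =
      with_proj (graph_union (Hv # Hw # concat (map Hs [1..<d]) @ concat (map Js [1..<d - 1])))"
    using assms unfolding built_\<G>_def Let_def by (elim conjE exE) metis
  interpret pair_graph H by (rule gr)
  define Cs where "Cs = Hv # Hw # concat (map Hs [1..<d]) @ concat (map Js [1..<d - 1])"
  define P where "P = u ` {0..d}"
  define X where "X = verts_of Cs"
  \<comment> \<open>\<open>Hs\<close> and \<open>Js\<close> are total functions whose values outside
    the stated ranges do not enter the graph. Replacing these by \<open>{}\<close> lets one
    neighbourhood formula serve all \<open>i\<close>, also for \<open>d = 2\<close>.\<close>
  define W where "W i = (if 1 \<le> i \<and> i < d then verts_of (Hs i) else {})" for i
  define J where "J i = (if 1 \<le> i \<and> i < d - 1 then verts_of (Js i) else {})" for i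
  note complete = complete[folded Cs_def] and pd = pd[folded Cs_def]
    and PX = PCs[folded Cs_def, folded P_def X_def] and V = V[folded Cs_def, folded P_def X_def]
    and outside = outside[folded Cs_def, folded P_def]
  have sym: "(x, y) \<in> parcs H \<longleftrightarrow> (y, x) \<in> parcs H" for x y
    using arcs_symmetric by blast
  have ueq: "u i = u j \<longleftrightarrow> i = j" if "i \<le> d" "j \<le> d" for i j
    using inj_on_eq_iff[OF inj] that by simp
  have uP: "u i \<in> P" "u i \<notin> X" if "i \<le> d" for i
  proof -
    show "u i \<in> P" using that by (auto simp: P_def)
    then show "u i \<notin> X" using PX by blast
  qed
  have X: "X = pverts Hv \<union> pverts Hw \<union> (\<Union>i. W i) \<union> (\<Union>i. J i)"
    by (auto simp: X_def Cs_def W_def J_def split: if_splits)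
  have pd': "pverts Hv \<inter> pverts Hw = {}" "pairwise_disjoint_verts (concat (map Hs [1..<d]))"
    "pairwise_disjoint_verts (concat (map Js [1..<d - 1]))"
    using pd unfolding Cs_def by auto
  have WW: "W i \<inter> W j = {}" if "i \<noteq> j" for i j
    using pairwise_disjoint_verts_concat_mapD[OF pd'(2), of i j] that by (auto simp: W_def)
  have JJ: "J i \<inter> J j = {}" if "i \<noteq> j" for i j
    using pairwise_disjoint_verts_concat_mapD[OF pd'(3), of i j] that by (auto simp: J_def)
  have U: "(\<Union>i. W i) = verts_of (concat (map Hs [1..<d]))"
    "(\<Union>i. J i) = verts_of (concat (map Js [1..<d - 1]))"
    by (auto simp: W_def J_def split: if_splits)
  have "pverts Hv \<inter> (\<Union>i. W i) = {}" "pverts Hv \<inter> (\<Union>i. J i) = {}"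
    "pverts Hw \<inter> (\<Union>i. W i) = {}" "pverts Hw \<inter> (\<Union>i. J i) = {}" "(\<Union>i. W i) \<inter> (\<Union>i. J i) = {}"
    using pd unfolding Cs_def U pairwise_disjoint_verts_simps verts_of_simps(2,3) by blast+
  then have D: "x \<in> pverts Hv \<Longrightarrow> x \<notin> W i" "x \<in> pverts Hv \<Longrightarrow> x \<notin> J i"
    "x \<in> pverts Hw \<Longrightarrow> x \<notin> W i" "x \<in> pverts Hw \<Longrightarrow> x \<notin> J i" "x \<in> W i \<Longrightarrow> x \<notin> J j" for x i j
    by (auto simp: disjoint_iff)
  have "x \<in> pverts Hv \<Longrightarrow> x \<notin> pverts Hw" for x using pd'(1) by blast
  with D have dis: "x \<in> pverts Hv \<Longrightarrow> x \<notin> pverts Hw \<and> x \<notin> W i \<and> x \<notin> J i"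
    "x \<in> pverts Hw \<Longrightarrow> x \<notin> pverts Hv \<and> x \<notin> W i \<and> x \<notin> J i"
    "x \<in> W i \<Longrightarrow> x \<notin> pverts Hv \<and> x \<notin> pverts Hw \<and> x \<notin> J j"
    "x \<in> J i \<Longrightarrow> x \<notin> pverts Hv \<and> x \<notin> pverts Hw \<and> x \<notin> W j" for x i j
    by metis+
  have dW: "x \<in> W i \<Longrightarrow> x \<in> W j \<Longrightarrow> i = j" and dJ: "x \<in> J i \<Longrightarrow> x \<in> J j \<Longrightarrow> i = j" for x i j
    using WW JJ by blast+
  have nbr: "nbrs H (u i) = {u (i - 1), u (i + 1)} \<union> (if i = 1 then pverts Hv else {}) \<union>
      (if i = d - 1 then pverts Hw else {}) \<union> W i \<union> J (i - 1) \<union> J i"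
    if i: "1 \<le> i" "i < d" for i
  proof (cases "d = 2")
    case True
    then have "i = 1" using i by simp
    then show ?thesis using n2 True by (auto simp: W_def J_def numeral_2_eq_2)
  next
    case False
    then have d3: "3 \<le> d" using d by simp
    consider "i = 1" | "i = d - 1" | "i \<in> {2..d - 2}" using i by force
    then show ?thesis
    proof cases
      case 1
      then show ?thesis using n3[OF d3] d3 by (auto simp: W_def J_def numeral_2_eq_2)
    next
      case 2
      have "d - 1 - 1 = d - 2" "d - 1 + 1 = d" using d by auto
      then show ?thesis using n3[OF d3] d3 2 by (auto simp: W_def J_def)
    next
      case 3
      then show ?thesis using n3[OF d3] d3 by (auto simp: W_def J_def)
    qed
  qed
  have adj: "(u i, u j) \<in> parcs H \<longleftrightarrow> j = Suc i \<or> i = Suc j" if ij: "i \<le> d" "j \<le> d" for i j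
  proof -
    have uj: "u j \<notin> pverts Hv" "u j \<notin> pverts Hw" "u j \<notin> W k" "u j \<notin> J k" for k
      using uP(2)[OF ij(2)] unfolding X by blast+
    have "u j \<in> nbrs H (u i) \<longleftrightarrow> j = Suc i \<or> i = Suc j"
    proof -
      consider "i = 0" | "i = d" | "1 \<le> i" "i < d" using ij by force
      then show ?thesis
      proof cases
        case 1
        then show ?thesis using nv uj ueq[of j 1] ij d by auto
      next
        case 2
        then show ?thesis using nw uj ueq[of j "d - 1"] ij d by auto
      next
        case 3
        then show ?thesis
          unfolding nbr[OF 3] using uj ueq[of j "i - 1"] ueq[of j "i + 1"] ij d by auto
      qed
    qed
    then show ?thesis by (simp add: nbrs_def)
  qed
  have EC: "parcs C = {(x, y). x \<in> pverts C \<and> y \<in> pverts C \<and> x \<noteq> y}" if "C \<in> set Cs" for C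
    using complete that by (auto simp: complete_digraph_pair_def)
  \<comment> \<open>Off the path the graph is the union of the cliques, and disjointness makes
    \<open>C\<close> the only one containing \<open>x\<close>.\<close>
  have arcX: "(x, y) \<in> parcs H \<longleftrightarrow> y \<in> pverts C \<and> x \<noteq> y"
    if C: "C \<in> set Cs" "x \<in> pverts C" and y: "y \<in> X" for C x y
  proof -
    have "x \<in> X" using C by (auto simp: X_def verts_of_def)
    have "pverts H - P = X" using V PX by blast
    then have "arcs (with_proj H \<restriction> X) = arcs_of Cs"
      using outside by (simp add: graph_union_eq)
    moreover have "arcs (with_proj H \<restriction> X) = parcs H \<inter> X \<times> X" by auto
    ultimately have "parcs H \<inter> X \<times> X = arcs_of Cs" by simp
    then have "(x, y) \<in> parcs H \<longleftrightarrow> (x, y) \<in> arcs_of Cs"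
      using \<open>x \<in> X\<close> y by blast
    also have "\<dots> \<longleftrightarrow> y \<in> pverts C \<and> x \<noteq> y"
      using C EC pairwise_disjoint_verts_unique[OF pd] unfolding arcs_of_def by fastforce
    finally show ?thesis .
  qed
  have empty: "W 0 = {}" "W d = {}" "J 0 = {}" "J (d - 1) = {}" "J d = {}"
    by (auto simp: W_def J_def)
  \<comment> \<open>Covers the ends too: at \<open>i = 0\<close> truncated subtraction gives
    \<open>J 0\<close>, and at \<open>i = d\<close> it gives \<open>J (d - 1)\<close>, both
    empty.\<close>
  have mem: "x \<in> nbrs H (u i) \<longleftrightarrow> x \<in> pverts Hv \<and> (i = 0 \<or> i = 1) \<or>
      x \<in> pverts Hw \<and> (i = d - 1 \<or> i = d) \<or> x \<in> W i \<or> x \<in> J (i - 1) \<or> x \<in> J i"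
    if x: "x \<in> X" and i: "i \<le> d" for x i
  proof -
    have xu: "x \<noteq> u j" if "j \<le> d" for j using uP(2)[OF that] x by blast
    consider "i = 0" | "i = d" | "1 \<le> i" "i < d" using i by force
    then show ?thesis
    proof cases
      case 1
      then show ?thesis using nv xu[of 1] d empty by simp
    next
      case 2
      then show ?thesis using nw xu[of "d - 1"] d empty by simp
    next
      case 3
      then show ?thesis unfolding nbr[OF 3] using xu[of "i - 1"] xu[of "i + 1"] by simp
    qed
  qed
  \<comment> \<open>Each of the four kinds of clique sees at most two path vertices, and these are
    consecutive.\<close>
  have near: "j = Suc i \<or> i = Suc j"
    if x: "x \<in> X" "x \<in> nbrs H (u i)" "x \<in> nbrs H (u j)" and ij: "i \<le> d" "j \<le> d" "i \<noteq> j" for x i j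
  proof -
    note m = x(2)[unfolded mem[OF x(1) ij(1)]] x(3)[unfolded mem[OF x(1) ij(2)]]
    from x(1) consider "x \<in> pverts Hv" | "x \<in> pverts Hw" | k where "x \<in> W k" | k where "x \<in> J k"
      unfolding X by blast
    then show ?thesis
    proof cases
      case 1
      then show ?thesis using m dis(1)[OF 1] ij(3) by auto
    next
      case 2
      then show ?thesis using m dis(2)[OF 2] ij(3) d by auto
    next
      case 3
      then have "i = k" "j = k" using m dis(3)[OF 3] dW by blast+
      then show ?thesis using ij(3) by simp
    next
      case 4
      then have "k \<noteq> 0" using empty(3) by (metis empty_iff)
      moreover have "i = k \<or> i - 1 = k" "j = k \<or> j - 1 = k" using m dis(4)[OF 4] dJ[OF 4] by blast+
      ultimately show ?thesis using ij(3) by auto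
    qed
  qed
  \<comment> \<open>Which path vertices are seen depends only on the block \<open>Hv\<close>,
    \<open>Hw\<close>, \<open>W k\<close> or \<open>J k\<close> that contains the clique.\<close>
  have same: "y \<in> nbrs H (u i)"
    if C: "C \<in> set Cs" "x \<in> pverts C" "y \<in> pverts C" and x: "x \<in> nbrs H (u i)" and i: "i \<le> d" for C x y i
  proof -
    have "x \<in> X" "y \<in> X" using C by (auto simp: X_def verts_of_def)
    note m = x[unfolded mem[OF this(1) i]] and mem_y = mem[OF this(2) i]
    from C(1) consider "C = Hv" | "C = Hw" | k where "1 \<le> k" "k < d" "C \<in> set (Hs k)"
      | k where "1 \<le> k" "k < d - 1" "C \<in> set (Js k)"
      unfolding Cs_def by auto
    then show ?thesis
    proof cases
      case 1
      then show ?thesis using m C dis(1)[of x] unfolding mem_y by blast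
    next
      case 2
      then show ?thesis using m C dis(2)[of x] unfolding mem_y by blast
    next
      case 3
      then have "x \<in> W k" "y \<in> W k" using C by (auto simp: W_def verts_of_def)
      then show ?thesis using m dis(3)[of x k] dW[of x k] unfolding mem_y by blast
    next
      case 4
      then have "x \<in> J k" "y \<in> J k" using C by (auto simp: J_def verts_of_def)
      then show ?thesis using m dis(4)[of x k] dJ[of x k] unfolding mem_y by blast
    qed
  qed
  have HvCs: "Hv \<in> set Cs" "Hw \<in> set Cs" by (simp_all add: Cs_def)
  have HX: "pverts Hv \<subseteq> X" "pverts Hw \<subseteq> X" unfolding X by blast+
  \<comment> \<open>Two path neighbours are adjacent by \<open>near\<close>, a path neighbour and a
    clique neighbour by \<open>same\<close>, two clique neighbours by \<open>arcX\<close>.\<close>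
  have free_X: "x \<in> free_verts H" if x: "x \<in> X" for x
  proof -
    obtain C where C: "C \<in> set Cs" "x \<in> pverts C" using x by (auto simp: X_def verts_of_def)
    have CP: "(y, u i) \<in> parcs H" if "(x, u i) \<in> parcs H" "y \<in> pverts C" "i \<le> d" for y i
      using same[OF C that(2), of i] that sym by (simp add: nbrs_def)
    have "(y, z) \<in> parcs H" if yz: "(x, y) \<in> parcs H" "(x, z) \<in> parcs H" "y \<noteq> z" for y z
    proof -
      have "y \<in> P \<or> y \<in> X" "z \<in> P \<or> z \<in> X" using yz in_arcsD2 V by blast+
      then consider "y \<in> P" "z \<in> P" | "y \<in> P" "z \<in> X" | "y \<in> X" "z \<in> P" | "y \<in> X" "z \<in> X"
        by blast
      then show ?thesis
      proof cases
        case 1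
        then obtain i j where ij: "y = u i" "z = u j" "i \<le> d" "j \<le> d" by (auto simp: P_def)
        then have "j = Suc i \<or> i = Suc j"
          using near[OF x, of i j] yz sym by (auto simp: nbrs_def)
        then show ?thesis using adj ij by simp
      next
        case 2
        then obtain i where "y = u i" "i \<le> d" by (auto simp: P_def)
        then show ?thesis using CP arcX[OF C 2(2)] yz sym by blast
      next
        case 3
        then obtain i where "z = u i" "i \<le> d" by (auto simp: P_def)
        then show ?thesis using CP arcX[OF C 3(1)] yz by blast
      next
        case 4
        then show ?thesis using arcX[OF C] arcX[OF C(1) _ 4(2)] yz by blast
      qed
    qed
    then show ?thesis using x V unfolding free_verts_iff by blast
  qed
  \<comment> \<open>Serves both ends: the neighbourhood is one clique plus the next path vertex,
    which is adjacent to the whole clique.\<close>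
  have free_end: "u i \<in> free_verts H"
    if i: "i \<le> d" "j \<le> d" and n: "nbrs H (u i) = {u j} \<union> pverts C" and C: "C \<in> set Cs"
      and Cj: "pverts C \<subseteq> nbrs H (u j)" for i j C
  proof -
    have CX: "pverts C \<subseteq> X" using C by (auto simp: X_def verts_of_def)
    have "(y, z) \<in> parcs H" if "y \<in> {u j} \<union> pverts C" "z \<in> {u j} \<union> pverts C" "y \<noteq> z" for y z
      using that Cj sym arcX[OF C, of y z] CX unfolding nbrs_def by blast
    then show ?thesis using uP(1)[OF i(1)] V n unfolding free_verts_def by blast
  qed
  have "u 0 \<in> free_verts H"
    by (rule free_end[of 0 1 Hv]) (use d nv HvCs nbr[of 1] in auto)
  moreover have "u d \<in> free_verts H"
    by (rule free_end[of d "d - 1" Hw]) (use d nw HvCs nbr[of "d - 1"] in auto)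
  moreover have "u i \<notin> free_verts H" if "i \<in> {1..<d}" for i
    using induced_path_inner_nonfree[OF inj adj that] .
  moreover have "P = {u 0, u d} \<union> u ` {1..<d}"
  proof -
    have "{0..d} = {0, d} \<union> {1..<d}" by auto
    then show ?thesis unfolding P_def by (metis image_Un image_insert image_empty)
  qed
  ultimately have "pverts H - free_verts H = u ` {1..<d}"
    unfolding V using free_X uP by fastforce
  moreover have "inj_on u {1..<d}" by (rule inj_on_subset[OF inj]) auto
  ultimately show "card (pverts H - free_verts H) = d - 1" by (simp add: card_image)
  \<comment> \<open>As \<open>x\<close> sees \<open>u 0\<close>, \<open>near\<close> leaves only
    \<open>u 1\<close> as a further path neighbour.\<close>
  have Hv_nbrs: "nbrs H x \<subseteq> {u 0, u 1} \<union> pverts Hv" if x: "x \<in> pverts Hv" for x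
  proof
    fix y assume y: "y \<in> nbrs H x"
    then have E: "(x, y) \<in> parcs H" "(y, x) \<in> parcs H" using sym by (simp_all add: nbrs_def)
    have "y \<in> P \<or> y \<in> X" using E(1) in_arcsD2 V by blast
    then show "y \<in> {u 0, u 1} \<union> pverts Hv"
    proof
      assume "y \<in> P"
      then obtain i where i: "y = u i" "i \<le> d" by (auto simp: P_def)
      have "x \<in> X" "x \<in> nbrs H (u 0)" "x \<in> nbrs H (u i)"
        using x HX nv E(2) i by (auto simp: nbrs_def)
      then have "i = 0 \<or> i = 1" using near[of x 0 i] i(2) by auto
      then show ?thesis using i by auto
    qed (use arcX[OF HvCs(1) x] E in blast)
  qed
  show "\<exists>c\<in>pverts H. \<exists>A. A \<subset> pverts H - {c} \<and> A \<noteq> {} \<and> (\<forall>x\<in>A. nbrs H x \<subseteq> insert c A)"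
  proof (intro bexI[of _ "u 1"] exI[of _ "insert (u 0) (pverts Hv)"] conjI)
    have "u 0 \<noteq> u 1" "u 2 \<noteq> u 0" "u 2 \<noteq> u 1" using ueq[of 0 1] ueq[of 2 0] ueq[of 2 1] d by auto
    moreover have "u 1 \<notin> pverts Hv" "u 2 \<notin> pverts Hv" using uP(2) HX d by auto
    moreover have "u 0 \<in> pverts H" "u 2 \<in> pverts H" "pverts Hv \<subseteq> pverts H"
      using uP(1) HX V d by auto
    ultimately have "insert (u 0) (pverts Hv) \<subseteq> pverts H - {u 1}"
      "u 2 \<in> pverts H - {u 1}" "u 2 \<notin> insert (u 0) (pverts Hv)" by auto
    then show "insert (u 0) (pverts Hv) \<subset> pverts H - {u 1}" by blast
    show "\<forall>x\<in>insert (u 0) (pverts Hv). nbrs H x \<subseteq> insert (u 1) (insert (u 0) (pverts Hv))"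
      using Hv_nbrs nv by blast
    show "u 1 \<in> pverts H" using uP(1) V d by auto
  qed simp
qed

section \<open>Transport along isomorphisms\<close>

lemma card_nonfree_iso:
  assumes bij: "bij_betw \<phi> (pverts H) (pverts G)"
    and adj: "\<And>x y. x \<in> pverts H \<Longrightarrow> y \<in> pverts H \<Longrightarrow> (\<phi> x, \<phi> y) \<in> parcs G \<longleftrightarrow> (x, y) \<in> parcs H"
    and G: "pair_graph G" and H: "pair_graph H"
  shows "card (pverts G - free_verts G) = card (pverts H - free_verts H)"
proof -
  interpret G: pair_graph G by (rule G)
  interpret H: pair_graph H by (rule H)
  have inj: "inj_on \<phi> (pverts H)" and img: "pverts G = \<phi> ` pverts H"
    using bij by (auto simp: bij_betw_def)
  have free: "\<phi> x \<in> free_verts G \<longleftrightarrow> x \<in> free_verts H" if x: "x \<in> pverts H" for x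
  proof
    assume f: "\<phi> x \<in> free_verts G"
    have "(y, z) \<in> parcs H" if "(x, y) \<in> parcs H" "(x, z) \<in> parcs H" "y \<noteq> z" for y z
    proof -
      have yz: "y \<in> pverts H" "z \<in> pverts H" using that H.in_arcsD2 by blast+
      then have "\<phi> y \<noteq> \<phi> z" using that(3) inj_on_eq_iff[OF inj] by blast
      then show ?thesis using f adj x yz that unfolding G.free_verts_iff by blast
    qed
    then show "x \<in> free_verts H" using x unfolding H.free_verts_iff by blast
  next
    assume f: "x \<in> free_verts H"
    have "(y, z) \<in> parcs G" if yz: "(\<phi> x, y) \<in> parcs G" "(\<phi> x, z) \<in> parcs G" "y \<noteq> z" for y z
    proof -
      obtain a b where "y = \<phi> a" "z = \<phi> b" "a \<in> pverts H" "b \<in> pverts H"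
        using yz G.in_arcsD2 unfolding img by blast
      then show ?thesis using f adj x yz unfolding H.free_verts_iff by blast
    qed
    then show "\<phi> x \<in> free_verts G" using x img unfolding G.free_verts_iff by blast
  qed
  then have "pverts G - free_verts G = \<phi> ` (pverts H - free_verts H)"
    unfolding img by blast
  moreover have "inj_on \<phi> (pverts H - free_verts H)" by (rule inj_on_subset[OF inj]) auto
  ultimately show ?thesis by (simp add: card_image)
qed

text \<open>Unlike \<open>built_\<G>\<close>, the definition of \<open>built_\<F>\<close> does not
  state this. It is needed to compare nonfree vertices along an isomorphism.\<close>

lemma built_\<F>_pair_graph:
  assumes "built_\<F> q H"
  shows "pair_graph H"
proof -
  obtain K Fs where K: "complete_digraph q (with_proj K)"
    and Fs: "\<forall>F\<in>set Fs. \<exists>l\<ge>1. complete_digraph l (with_proj F)"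
    and KF: "pverts K \<inter> verts_of Fs = {}" and H: "H = graph_join K (graph_union Fs)"
    using assms unfolding built_\<F>_def by auto
  have V: "pverts H = pverts K \<union> verts_of Fs"
    and E: "parcs H = parcs K \<union> arcs_of Fs \<union> pverts K \<times> verts_of Fs \<union> verts_of Fs \<times> pverts K"
    unfolding H graph_join_def graph_union_eq by simp_all
  have EK: "finite (pverts K)" "parcs K = {(x, y). x \<in> pverts K \<and> y \<in> pverts K \<and> x \<noteq> y}"
    using K by (auto simp: complete_digraph_pair_def)
  have EF: "finite (pverts F)" "parcs F = {(x, y). x \<in> pverts F \<and> y \<in> pverts F \<and> x \<noteq> y}"
    if "F \<in> set Fs" for F
    using Fs that by (auto simp: complete_digraph_pair_def)
  have F: "x \<in> verts_of Fs \<and> y \<in> verts_of Fs \<and> x \<noteq> y \<and> (y, x) \<in> arcs_of Fs"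
    if "(x, y) \<in> arcs_of Fs" for x y
    using that EF(2) unfolding arcs_of_def verts_of_def by fastforce
  have arcs: "x \<in> pverts H \<and> y \<in> pverts H \<and> x \<noteq> y \<and> (y, x) \<in> parcs H" if "(x, y) \<in> parcs H" for x y
    using that F[of x y] KF unfolding V E EK(2) by blast
  have fin: "finite (pverts H)" unfolding V using EK(1) EF(1) by (simp add: verts_of_def)
  show ?thesis
  proof
    show "fst e \<in> pverts H" "snd e \<in> pverts H" "fst e \<noteq> snd e" if "e \<in> parcs H" for e
      using arcs[of "fst e" "snd e"] that by auto
    show "finite (pverts H)" by (rule fin)
    show "finite (parcs H)"
      by (rule finite_subset[of _ "pverts H \<times> pverts H"]) (use arcs fin in auto)
    show "symmetric (with_proj H)" using arcs by (auto simp: symmetric_def intro: symI)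
  qed
qed

context pair_graph
begin

text \<open>After deleting \<open>c\<close> no walk leaves \<open>A\<close>, and the strict
  inclusion leaves a vertex that is never reached.\<close>

lemma vertex_connectivity_cutvertex:
  assumes "c \<in> pverts G" "A \<subset> pverts G - {c}" "A \<noteq> {}" "\<And>x. x \<in> A \<Longrightarrow> nbrs G x \<subseteq> insert c A"
  shows "vertex_connectivity G \<le> 1"
proof -
  obtain x y where xy: "x \<in> A" "y \<in> pverts G - {c}" "y \<notin> A" using assms(2,3) by blast
  let ?R = "parcs G \<inter> (pverts G - {c}) \<times> (pverts G - {c})"
  have "z \<in> A" if "(x, z) \<in> ?R\<^sup>*" for z
    using that
  proof (induction rule: rtrancl_induct)
    case (step y z)
    then show ?case using assms(4)[of y] by (auto simp: nbrs_def)
  qed (rule xy)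
  then have "(x, y) \<notin> ?R\<^sup>*" using xy by blast
  then have "vertex_connectivity G \<le> card {c}"
    using assms(1,2) xy by (intro vertex_connectivity_le[of "{c}" x y]) auto
  then show ?thesis by simp
qed

text \<open>The cut vertex and the part it cuts off are carried along \<open>\<phi>\<close>, which
  bounds the connectivity of \<open>G\<close> directly.\<close>

lemma family_\<G>D:
  assumes "G \<in> family_\<G> d"
  shows "card (pverts G - free_verts G) = d - 1" "2 \<le> d" "vertex_connectivity G \<le> 1"
proof -
  obtain H :: "'a pair_pre_digraph" where H: "built_\<G> d H" "digraph_iso (with_proj H) (with_proj G)"
    using assms by (auto simp: family_\<G>_def)
  have gH: "pair_graph H" and "2 \<le> d" using H(1) by (auto simp: built_\<G>_def)
  then show "2 \<le> d" by simp
  obtain \<phi> where bij: "bij_betw \<phi> (pverts H) (pverts G)"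
    and adj: "\<And>x y. x \<in> pverts H \<Longrightarrow> y \<in> pverts H \<Longrightarrow> (\<phi> x, \<phi> y) \<in> parcs G \<longleftrightarrow> (x, y) \<in> parcs H"
    using digraph_iso_bij[OF H(2)] by blast
  show "card (pverts G - free_verts G) = d - 1"
    using card_nonfree_iso[OF bij adj pair_graph gH] built_\<G>D(1)[OF H(1)] by simp
  have inj: "inj_on \<phi> (pverts H)" and img: "pverts G = \<phi> ` pverts H"
    using bij by (auto simp: bij_betw_def)
  obtain c A where c: "c \<in> pverts H" and A: "A \<subset> pverts H - {c}" "A \<noteq> {}"
    and cut: "\<And>x. x \<in> A \<Longrightarrow> nbrs H x \<subseteq> insert c A"
    using built_\<G>D(2)[OF H(1)] by blast
  have mem: "\<phi> x \<in> \<phi> ` A \<longleftrightarrow> x \<in> A" if "x \<in> pverts H" for x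
    using inj_on_image_mem_iff[OF inj that] A(1) by blast
  have neq: "\<phi> x = \<phi> c \<longleftrightarrow> x = c" if "x \<in> pverts H" for x
    using inj_on_eq_iff[OF inj that c] .
  show "vertex_connectivity G \<le> 1"
  proof (rule vertex_connectivity_cutvertex)
    show "\<phi> c \<in> pverts G" "\<phi> ` A \<noteq> {}" using c A img by auto
    obtain y where y: "y \<in> pverts H" "y \<noteq> c" "y \<notin> A" using A(1) by blast
    then have "\<phi> y \<in> pverts G - {\<phi> c}" "\<phi> y \<notin> \<phi> ` A" using mem neq img by auto
    moreover have "\<phi> a \<in> pverts G - {\<phi> c}" if "a \<in> A" for a
      using A(1) neq[of a] that unfolding img by auto
    then have "\<phi> ` A \<subseteq> pverts G - {\<phi> c}" by (rule image_subsetI)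
    ultimately show "\<phi> ` A \<subset> pverts G - {\<phi> c}" by (metis psubsetI)
    show "nbrs G x \<subseteq> insert (\<phi> c) (\<phi> ` A)" if "x \<in> \<phi> ` A" for x
    proof
      fix y assume y: "y \<in> nbrs G x"
      obtain a where a: "x = \<phi> a" "a \<in> A" using \<open>x \<in> \<phi> ` A\<close> by blast
      obtain b where b: "y = \<phi> b" "b \<in> pverts H" using y in_arcsD2 img by (auto simp: nbrs_def)
      have "(a, b) \<in> parcs H" using adj[of a b] a b A(1) y by (auto simp: nbrs_def)
      then show "y \<in> insert (\<phi> c) (\<phi> ` A)" using cut[OF a(2)] b by (auto simp: nbrs_def)
    qed
  qed
qed

lemma family_\<F>D:
  assumes "G \<in> family_\<F> q"
  shows "card (pverts G - free_verts G) = q"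
    and "\<exists>c\<in>pverts G. \<forall>x\<in>pverts G. x \<noteq> c \<longrightarrow> (c, x) \<in> parcs G"
    and "\<exists>v\<in>pverts G. \<exists>w\<in>pverts G. v \<noteq> w \<and> (v, w) \<notin> parcs G"
proof -
  obtain H :: "'a pair_pre_digraph" where H: "built_\<F> q H" "digraph_iso (with_proj H) (with_proj G)"
    using assms by (auto simp: family_\<F>_def)
  obtain \<phi> where bij: "bij_betw \<phi> (pverts H) (pverts G)"
    and adj: "\<And>x y. x \<in> pverts H \<Longrightarrow> y \<in> pverts H \<Longrightarrow> (\<phi> x, \<phi> y) \<in> parcs G \<longleftrightarrow> (x, y) \<in> parcs H"
    using digraph_iso_bij[OF H(2)] by blast
  show "card (pverts G - free_verts G) = q"
    using card_nonfree_iso[OF bij adj pair_graph built_\<F>_pair_graph[OF H(1)]] built_\<F>D(1)[OF H(1)]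
    by simp
  have inj: "inj_on \<phi> (pverts H)" and img: "pverts G = \<phi> ` pverts H"
    using bij by (auto simp: bij_betw_def)
  obtain c where c: "c \<in> pverts H" "\<And>x. x \<in> pverts H \<Longrightarrow> x \<noteq> c \<Longrightarrow> (c, x) \<in> parcs H"
    using built_\<F>D(2)[OF H(1)] by blast
  have "(\<phi> c, \<phi> x) \<in> parcs G" if "x \<in> pverts H" "\<phi> x \<noteq> \<phi> c" for x
    using c adj[OF c(1) that(1)] that by auto
  then show "\<exists>c\<in>pverts G. \<forall>x\<in>pverts G. x \<noteq> c \<longrightarrow> (c, x) \<in> parcs G"
    using c(1) unfolding img by auto
  obtain v w where "v \<in> pverts H" "w \<in> pverts H" "v \<noteq> w" "(v, w) \<notin> parcs H"
    using built_\<F>D(3)[OF H(1)] by blast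
  then show "\<exists>v\<in>pverts G. \<exists>w\<in>pverts G. v \<noteq> w \<and> (v, w) \<notin> parcs G"
    using adj inj_on_eq_iff[OF inj] unfolding img by blast
qed

section \<open>The equivalence of the equation with membership in the families\<close>

lemma digraph_iso_refl: "digraph_iso (with_proj G) (with_proj G)"
proof -
  let ?f = "\<lparr>iso_verts = id, iso_arcs = id, iso_head = snd, iso_tail = fst\<rparr>"
  have "pre_digraph.digraph_isomorphism (with_proj G) ?f"
    by (simp add: pre_digraph.digraph_isomorphism_def wf_digraph_wp_iff pair_wf_digraph)
  moreover have "with_proj G = app_iso ?f (with_proj G)"
    by (simp add: app_iso_def with_proj_def)
  ultimately show ?thesis unfolding digraph_iso_def by blast
qed

text \<open>Stated additively to avoid truncated subtraction, with \<open>x\<close> and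
  \<open>y\<close> witnessing non-completeness. As \<open>1 \<le> ?k\<close>, the proof splits into
  \<open>?k = 1\<close> and \<open>2 \<le> ?k\<close>.\<close>

theorem num_free_plus_diam_iff:
  assumes conn: "connected (with_proj G)"
    and xy: "x \<in> pverts G" "y \<in> pverts G" "x \<noteq> y" "(x, y) \<notin> parcs G"
  shows "num_free G + diam G + vertex_connectivity G = card (pverts G) + 2 \<longleftrightarrow>
    G \<in> family_\<G> (diam G) \<or> (2 \<le> vertex_connectivity G \<and> G \<in> family_\<F> (vertex_connectivity G))"
proof -
  let ?N = "pverts G - free_verts G"
  let ?k = "vertex_connectivity G"
  have k: "1 \<le> ?k" by (rule vertex_connectivity_pos[OF conn xy])
  have d: "2 \<le> diam G" using gdist_ge_2[OF conn xy] gdist_le_diam[OF conn xy(1,2)] by simp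
  have eq: "num_free G + diam G + ?k = card (pverts G) + 2 \<longleftrightarrow> card ?N + 2 = diam G + ?k"
    using card_nonfree by linarith
  \<comment> \<open>Here \<open>card ?N = diam G - 1\<close>, and the inner vertices of a geodesic
    already supply that many nonfree vertices, so there are no others.\<close>
  have \<G>: "G \<in> family_\<G> (diam G)" if N: "card ?N + 2 = diam G + ?k" and "?k = 1"
  proof -
    obtain v w where vw: "v \<in> pverts G" "w \<in> pverts G" "gdist G v w = diam G"
      by (rule diam_attained[OF conn])
    obtain u where u: "inj_on u {0..diam G}" "u ` {0..diam G} \<subseteq> pverts G"
      "\<And>i j. i \<le> diam G \<Longrightarrow> j \<le> diam G \<Longrightarrow> (u i, u j) \<in> parcs G \<longleftrightarrow> j = Suc i \<or> i = Suc j"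
      by (rule geodesic[OF conn vw(1,2), unfolded vw(3)]) blast
    have "u i \<notin> free_verts G" if "i \<in> {1..<diam G}" for i
      using induced_path_inner_nonfree[OF u(1,3) that] .
    moreover have "u ` {1..<diam G} \<subseteq> u ` {0..diam G}" by auto
    ultimately have sub: "u ` {1..<diam G} \<subseteq> ?N" using u(2) by blast
    have "inj_on u {1..<diam G}" by (rule inj_on_subset[OF u(1)]) auto
    then have "card (u ` {1..<diam G}) = card ?N" using N \<open>?k = 1\<close> by (simp add: card_image)
    then have "u ` {1..<diam G} = ?N"
      using sub pair_finite_verts by (intro card_subset_eq) auto
    then have "built_\<G> (diam G) G" by (intro built_\<G>I[OF conn d u]) auto
    then show ?thesis unfolding family_\<G>_def using digraph_iso_refl by blast
  qed
  have \<F>: "G \<in> family_\<F> ?k" if N: "card ?N + 2 = diam G + ?k" and k2: "2 \<le> ?k"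
  proof -
    obtain v w where vw: "v \<in> pverts G" "w \<in> pverts G" "gdist G v w = diam G"
      by (rule diam_attained[OF conn])
    have "(diam G - 1) * ?k \<le> card ?N" using card_nonfree_ge[OF conn vw(1,2)] vw(3) by simp
    moreover obtain e l where e: "diam G = e + 2" "?k = l + 2"
      using d k2 by (metis add.commute le_add_diff_inverse)
    \<comment> \<open>Expanding leaves \<open>e * (l + 1) \<le> 0\<close>.\<close>
    ultimately have "(e + 1) * (l + 2) \<le> e + l + 2" using N by simp
    then have "e = 0" by (auto simp: algebra_simps)
    then have diam: "diam G = 2" using e by simp
    then have cN: "card ?N = ?k" using N by simp
    \<comment> \<open>A vertex with a non-neighbour has at least \<open>?k\<close> nonfree
      neighbours by \<open>card_nonfree_layer\<close> with \<open>i = 1\<close>. That is all of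
      \<open>?N\<close>, so the vertex is not in \<open>?N\<close> itself.\<close>
    have layer: "x \<in> free_verts G \<and> ?N \<subseteq> nbrs G x"
      if xy: "x \<in> pverts G" "y \<in> pverts G" "x \<noteq> y" "(x, y) \<notin> parcs G" for x y
    proof -
      let ?L = "{z \<in> ?N. gdist G x z = 1}"
      have "?k \<le> card ?L"
        using card_nonfree_layer[OF conn xy(1,2), of 1] gdist_ge_2[OF conn xy] by simp
      then have "?L = ?N"
        using cN pair_finite_verts by (intro card_seteq) auto
      moreover have "(x, z) \<in> parcs G" if "z \<in> pverts G" "gdist G x z = 1" for z
        using gdist_relpow[OF conn xy(1) that(1)] that(2) by simp
      ultimately have "?N \<subseteq> nbrs G x" by (auto simp: nbrs_def)
      moreover have "x \<notin> ?N" using \<open>?N \<subseteq> nbrs G x\<close> no_loops' by (auto simp: nbrs_def)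
      ultimately show ?thesis using xy by blast
    qed
    have yx: "(y, x) \<notin> parcs G" using xy arcs_symmetric by blast
    have free: "x \<in> free_verts G" "y \<in> free_verts G"
      using layer[OF xy] layer[OF xy(2,1) xy(3)[symmetric] yx] by blast+
    have join: "(z, s) \<in> parcs G" if z: "z \<in> free_verts G" and s: "s \<in> ?N" for z s
    proof -
      have zV: "z \<in> pverts G" using z free_verts_subset by blast
      \<comment> \<open>To apply \<open>layer\<close> to \<open>z\<close>, a non-neighbour is
        needed: a free vertex cannot be adjacent to both \<open>x\<close> and \<open>y\<close>,
        which are nonadjacent.\<close>
      have "\<exists>t\<in>pverts G. z \<noteq> t \<and> (z, t) \<notin> parcs G"
      proof (cases "z = x \<or> (z, x) \<notin> parcs G")
        case True
        then show ?thesis using xy yx by metis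
      next
        case False
        then have "(z, y) \<notin> parcs G" using z xy(3,4) unfolding free_verts_iff by metis
        moreover have "z \<noteq> y" using False yx by blast
        ultimately show ?thesis using xy(2) by blast
      qed
      then show ?thesis using layer[OF zV] s by (auto simp: nbrs_def)
    qed
    have "built_\<F> ?k G"
      using built_\<F>I[OF _ join free xy(3,4)] k2 unfolding cN by blast
    then show ?thesis unfolding family_\<F>_def using digraph_iso_refl by blast
  qed
  \<comment> \<open>The cut vertex together with \<open>k\<close> forces \<open>?k = 1\<close>,
    which matches \<open>card ?N = diam G - 1\<close>.\<close>
  have "card ?N + 2 = diam G + ?k" if "G \<in> family_\<G> (diam G)"
    using family_\<G>D[OF that] k by simp
  moreover have "card ?N + 2 = diam G + ?k" if "G \<in> family_\<F> ?k"
  proof -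
    obtain c where "c \<in> pverts G" "\<And>z. z \<in> pverts G \<Longrightarrow> z \<noteq> c \<Longrightarrow> (c, z) \<in> parcs G"
      using family_\<F>D(2)[OF \<open>G \<in> family_\<F> ?k\<close>] by blast
    then have "diam G = 2" by (rule diam_eq_2[OF conn _ _ xy])
    then show ?thesis using family_\<F>D(1)[OF that] by simp
  qed
  ultimately show ?thesis unfolding eq using \<G> \<F> k by force
qed

end

theorem theorem2p4:
  fixes G :: "nat pair_pre_digraph" and n :: nat
  assumes "pair_graph G"
    and "pverts G = {1..n}"
    and "Digraph_Component.connected (with_proj G)"
    and "\<not> complete_digraph n (with_proj G)"
  shows "int (num_free G) + int (diam G) = int n + 2 - int (vertex_connectivity G) \<longleftrightarrow>
    G \<in> family_\<G> (diam G) \<or> (2 \<le> vertex_connectivity G \<and> G \<in> family_\<F> (vertex_connectivity G))"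
proof -
  interpret pair_graph G by (rule assms(1))
  \<comment> \<open>Since \<open>pverts G = {1..n}\<close> is finite of size \<open>n\<close>, only
    the arc set can violate completeness. It is then a proper subset of the off-diagonal pairs,
    which yields a nonadjacent pair.\<close>
  have "parcs G \<noteq> {(u, v). (u, v) \<in> pverts G \<times> pverts G \<and> u \<noteq> v}"
    using assms(2,4) by (auto simp: complete_digraph_pair_def)
  moreover have "parcs G \<subseteq> {(u, v). (u, v) \<in> pverts G \<times> pverts G \<and> u \<noteq> v}"
    using in_arcsD1 in_arcsD2 no_loops' by blast
  ultimately obtain x y where "x \<in> pverts G" "y \<in> pverts G" "x \<noteq> y" "(x, y) \<notin> parcs G"
    by blast
  note num_free_plus_diam_iff[OF assms(3) this]
  moreover have "int (num_free G) + int (diam G) = int n + 2 - int (vertex_connectivity G) \<longleftrightarrow>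
    num_free G + diam G + vertex_connectivity G = card (pverts G) + 2"
    using assms(2) by auto
  ultimately show ?thesis by simp
qed

end
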